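(* Let $0<q<1$, $\Sigma\sim\mathrm{Mallows}(\mathbb{Z},q)$, and for $i\ge1$ let $m_i$ be the centering constants of the Gaussian limit for cycle counts of $\Pi_n\sim\mathrm{Mallows}(n,q)$, i.e. the (unique) constants such that $n^{-1/2}(C_1(\Pi_n)-m_1n,\dots,C_\ell(\Pi_n)-m_\ell n)$ converges in distribution to a centered multivariate normal for every $\ell$; equivalently $m_i=\lim_{n\to\infty}\mathbb{E}\,C_i(\Pi_n)/n$. Then: (1) For $i=1,2,\dots$, $m_i=\frac1i\,\mathbb{P}(0\text{ lies in an }i\text{-cycle of }\Sigma)$; in particular $m_1=\mathbb{P}(\Sigma(0)=0)$. (2) $\sum_{i=1}^\infty i\,m_i=1$. (3) $(m_1,m_2,m_3,\dots)\to(1,0,0,\dots)$ as $q\downarrow0$ and $(m_1,m_2,m_3,\dots)\to(0,0,0,\dots)$ as $q\uparrow1$, with convergence in the $\ell_1$-norm. Moreover $m_1=1-2q+o(q)$ as $q\downarrow0$ and $m_1=\frac{1-q}{4}+o(1-q)$ as $q\uparrow1$.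
   Context: For a finite set $A\subseteq\mathbb{Z}$ and a bijection $\pi:A\to A$, $\mathrm{inv}(\pi)$ is the number of pairs $i<j$ in $A$ with $\pi(i)>\pi(j)$, and $\Pi_A\sim\mathrm{Mallows}(A,q)$ means $\mathbb{P}(\Pi_A=\pi)\propto q^{\mathrm{inv}(\pi)}$ over bijections $\pi$ of $A$; $\mathrm{Mallows}(n,q):=\mathrm{Mallows}([n],q)$ with $[n]=\{1,\dots,n\}$. For a bijection $\sigma$ of a set $B\subseteq\mathbb{Z}$ and finite $A\subseteq B$, the pattern $\sigma_A:A\to A$ is defined by $\sigma_A(a)=a_{(i)}$ when $\sigma(a)$ is the $i$-th smallest element of $\sigma[A]$, where $a_{(i)}$ is the $i$-th smallest element of $A$. For $0<q<1$, $\mathrm{Mallows}(\mathbb{Z},q)$ is Gnedin and Olshanski's bi-infinite Mallows measure: the law of a random bijection $\Sigma$ of $\mathbb{Z}$ such that $\Sigma_I\sim\mathrm{Mallows}(I,q)$ for every finite interval of integers $I$, and, with $I_n=\{-n,\dots,n\}$, almost surely for every $i\in\mathbb{Z}$ one has $\Sigma_{I_n}(i)=\Sigma(i)$ for all sufficiently large $n$. $C_i(\pi)$ denotes the number of cycles of length $i$ of a permutation $\pi$. *)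

theory Defs
  imports "HOL-Probability.Probability" "HOL-Combinatorics.Permutations" "HOL-Library.Landau_Symbols"
begin

definition inv_count :: "int set \<Rightarrow> (int \<Rightarrow> int) \<Rightarrow> nat" where
  "inv_count A p = card {(i, j). i \<in> A \<and> j \<in> A \<and> i < j \<and> p i > p j}"

definition mallows_prob :: "int set \<Rightarrow> real \<Rightarrow> (int \<Rightarrow> int) \<Rightarrow> real" where
  "mallows_prob A q p =
     q ^ inv_count A p / (\<Sum>s\<in>{s. s permutes A}. q ^ inv_count A s)"

definition pattern :: "(int \<Rightarrow> int) \<Rightarrow> int set \<Rightarrow> (int \<Rightarrow> int)" where
  "pattern sg A = (\<lambda>a. if a \<in> A then
      (THE x. x \<in> A \<and> card {y\<in>A. y < x} = card {b\<in>sg ` A. b < sg a})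
    else a)"

text \<open>The (forward) orbit of x under f; for a bijection this is the cycle of x
  when x lies in a finite cycle (and infinite otherwise).\<close>
definition orb :: "(int \<Rightarrow> int) \<Rightarrow> int \<Rightarrow> int set" where
  "orb f x = {(f ^^ k) x | k. True}"

definition cycle_count :: "nat \<Rightarrow> int set \<Rightarrow> (int \<Rightarrow> int) \<Rightarrow> nat" where
  "cycle_count i A p = card {C. \<exists>x\<in>A. C = orb p x \<and> card C = i}"

definition exp_cycles :: "real \<Rightarrow> nat \<Rightarrow> nat \<Rightarrow> real" where
  "exp_cycles q i n = (\<Sum>p\<in>{p. p permutes {1..int n}}.
      mallows_prob {1..int n} q p * real (cycle_count i {1..int n} p))"

definition mconst :: "real \<Rightarrow> nat \<Rightarrow> real" where
  "mconst q i = lim (\<lambda>n. exp_cycles q i n / real n)"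

text \<open>Sg (a random bijection of Z on the probability space M) has law Mallows(Z,q)
  (Gnedin--Olshanski).\<close>
definition mallows_Z :: "'a measure \<Rightarrow> real \<Rightarrow> ('a \<Rightarrow> int \<Rightarrow> int) \<Rightarrow> bool" where
  "mallows_Z M q Sg \<longleftrightarrow>
     prob_space M \<and>
     (\<forall>w\<in>space M. bij (Sg w)) \<and>
     (\<forall>i. (\<lambda>w. Sg w i) \<in> measurable M (count_space UNIV)) \<and>
     (\<forall>a b p. a \<le> b \<longrightarrow> p permutes {a..b} \<longrightarrow>
        measure M {w\<in>space M. pattern (Sg w) {a..b} = p} = mallows_prob {a..b} q p) \<and>
     (AE w in M. \<forall>i. eventually (\<lambda>n. pattern (Sg w) {- int n..int n} i = Sg w i) sequentially)"

end

(*
  Say that a permutation is cut at c if it preserves the set of points up to c. Between the closest cuts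
  around 0 there is a block whose weight factors out of q^inv, so with Z_n = [n]_q! the expectation under
  Mallows({-a..b}, q) of a function of the orbit of 0 is a sum over blocks {-s..t} of
  Z_(a-s) Z_(b-t) / Z_(a+b+1) times the weight of the block. As (1 - q)^n Z_n decreases to a positive limit,
  dominated convergence gives the limit as a and b tend to infinity; since the total mass is always 1, no
  mass escapes to infinite blocks. Averaging over the position of the point gives i m_i = P(0 in an i-cycle)
  and the sum of the i m_i is 1.

  As q tends to 1: if the values at the positions below x are known, at most one value at x makes x the
  maximum of its cycle, so the expected number of cycles is at most the sum of the 1/[j]_q for j = 1..n, and
  the sum of the m_i is at most 1 - q.

  For m_1: deleting the fixed point 0 gives m_1 = (1 - q) E X^2 where X = q^R and R is the number of points
  moved from the left half to the right half. The explicit law of R gives, in the limit,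
  E[X^k (1 - X)^2] = q^(k+1) E[X^(k+2)], and k = 0, 1 suffice for both expansions.
*)

theory Submission
  imports Defs "HOL-Combinatorics.Multiset_Permutations" "HOL-Combinatorics.Orbits"
begin

section \<open>Inversions of lists and q-factorials\<close>

text \<open>Cycle length is not a local statistic: the orbit of 0 may wander far, and in the limit
  mass could be lost to infinite orbits. Confining the orbit to a block restores locality. The ends
  of {-a..b} grow independently because one limit has to serve twice: on centred windows, to be
  compared with the patterns of Sigma, and at all positions of {1..n}, to be averaged. The constants
  thus come, for every q, from finite permutations; the random bijection of Z enters only in the
  last section.

  Sums of q^inv are computed on words of values, where the inversions caused by the first letter
  depend only on its rank, so that the weight factors letter by letter.

  For \<open>mconst q 1\<close>, the identities for k = 0, 1 involve E X, E X^2 and E X^3, one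
  unknown too many. Inequalities close the system: the coefficient of E X^3 is of order 1 - q as q
  tends to 1, and X is either 1 or at most q, so that 0 <= X^2 - X^3 <= q^2, which settles q tending
  to 0.\<close>

fun list_inv :: "'a::linorder list \<Rightarrow> nat" where
  "list_inv [] = 0"
| "list_inv (x # xs) = card {y \<in> set xs. y < x} + list_inv xs"

definition qint :: "real \<Rightarrow> nat \<Rightarrow> real" where
  "qint q n = (\<Sum>j<n. q ^ j)"

definition qfact :: "real \<Rightarrow> nat \<Rightarrow> real" where
  "qfact q n = (\<Prod>j=1..n. qint q j)"

lemma qint_0 [simp]: "qint q 0 = 0"
  by (simp add: qint_def)

lemma qint_Suc: "qint q (Suc n) = qint q n + q ^ n"
  by (simp add: qint_def)

lemma qint_add: "qint q (m + n) = qint q m + q ^ m * qint q n"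
  by (induction n) (simp_all add: qint_Suc power_add algebra_simps)

lemma qint_nonneg: "0 \<le> q \<Longrightarrow> 0 \<le> qint q n"
  by (simp add: qint_def sum_nonneg)

lemma qint_pos: "0 < q \<Longrightarrow> 0 < n \<Longrightarrow> 0 < qint q n"
  by (cases n) (auto simp: qint_Suc intro!: add_nonneg_pos qint_nonneg)

lemma qint_geometric: "(1 - q) * qint q n = 1 - q ^ n"
  by (simp add: qint_def sum_gp_basic one_diff_power_eq)

lemma qfact_0 [simp]: "qfact q 0 = 1"
  by (simp add: qfact_def)

lemma qfact_Suc: "qfact q (Suc n) = qint q (Suc n) * qfact q n"
  by (simp add: qfact_def mult.commute)

lemma qfact_pos: "0 < q \<Longrightarrow> 0 < qfact q n"
  unfolding qfact_def by (intro prod_pos) (auto intro: qint_pos)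

text \<open>Each rank occurs once; adding a new maximum leaves the other ranks unchanged. For powers
  of q this is why a free choice of the next letter of a word contributes a factor
  \<open>qint\<close>.\<close>

lemma sum_rank:
  fixes B :: "'a::linorder set" and g :: "nat \<Rightarrow> real"
  assumes "finite B"
  shows "(\<Sum>x\<in>B. g (card {y \<in> B. y < x})) = (\<Sum>j<card B. g j)"
  using assms
proof (induction B rule: finite_linorder_max_induct)
  case empty
  then show ?case by simp
next
  case (insert b A)
  have "b \<notin> A" using insert by auto
  have "{y \<in> insert b A. y < b} = A" using insert by auto
  moreover have "{y \<in> insert b A. y < x} = {y \<in> A. y < x}" if "x \<in> A" for x
    using insert(2) that by force
  ultimately show ?case using insert \<open>b \<notin> A\<close> by (simp add: add.commute)
qed

lemma sum_rank_power: "finite B \<Longrightarrow> (\<Sum>x\<in>B. q ^ card {y \<in> B. y < x}) = qint q (card B)"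
  for B :: "'a::linorder set"
  by (simp add: sum_rank qint_def)

lemma sum_rank_power_below:
  fixes B :: "'a::linorder set"
  assumes "finite B"
  shows "(\<Sum>x\<in>{x \<in> B. x < v}. q ^ card {y \<in> B. y < x}) = qint q (card {x \<in> B. x < v})"
proof -
  have "(\<Sum>x\<in>{x \<in> B. x < v}. q ^ card {y \<in> B. y < x})
      = (\<Sum>x\<in>{x \<in> B. x < v}. q ^ card {y \<in> {x \<in> B. x < v}. y < x})"
    by (rule sum.cong) (auto intro!: arg_cong[where f = card] arg_cong2[where f = power])
  also have "\<dots> = qint q (card {x \<in> B. x < v})"
    by (rule sum_rank_power) (use assms in simp)
  finally show ?thesis .
qed

lemma sum_rank_power_above:
  fixes B :: "'a::linorder set"
  assumes "finite B"
  shows "(\<Sum>x\<in>{x \<in> B. \<not> x < v}. q ^ card {y \<in> B. y < x})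
    = q ^ card {x \<in> B. x < v} * qint q (card {x \<in> B. \<not> x < v})"
proof -
  have "q ^ card {y \<in> B. y < x}
      = q ^ card {x \<in> B. x < v} * q ^ card {y \<in> {x \<in> B. \<not> x < v}. y < x}"
    if "x \<in> {x \<in> B. \<not> x < v}" for x
  proof -
    have "{y \<in> B. y < x} = {x \<in> B. x < v} \<union> {y \<in> {x \<in> B. \<not> x < v}. y < x}"
      using that by auto
    moreover have "card ({x \<in> B. x < v} \<union> {y \<in> {x \<in> B. \<not> x < v}. y < x})
        = card {x \<in> B. x < v} + card {y \<in> {x \<in> B. \<not> x < v}. y < x}"
      using assms by (intro card_Un_disjoint) auto
    ultimately show ?thesis by (simp add: power_add)
  qed
  then have "(\<Sum>x\<in>{x \<in> B. \<not> x < v}. q ^ card {y \<in> B. y < x})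
    = (\<Sum>x\<in>{x \<in> B. \<not> x < v}. q ^ card {x \<in> B. x < v} * q ^ card {y \<in> {x \<in> B. \<not> x < v}. y < x})"
    by (rule sum.cong[OF refl])
  also have "\<dots> = q ^ card {x \<in> B. x < v} * qint q (card {x \<in> B. \<not> x < v})"
    unfolding sum_distrib_left[symmetric]
    by (rule arg_cong[OF sum_rank_power]) (use assms in simp)
  finally show ?thesis .
qed

section \<open>Words without repetition, weighted by their inversions\<close>

lemma sum_permutations_of_set_Cons:
  fixes f :: "'a list \<Rightarrow> 'b::comm_monoid_add"
  assumes "finite B" "B \<noteq> {}"
  shows "(\<Sum>zs\<in>permutations_of_set B. f zs)
    = (\<Sum>x\<in>B. \<Sum>zs\<in>permutations_of_set (B - {x}). f (x # zs))"
proof -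
  have "(\<Sum>zs\<in>permutations_of_set B. f zs)
      = (\<Sum>x\<in>B. \<Sum>zs\<in>(#) x ` permutations_of_set (B - {x}). f zs)"
    unfolding permutations_of_set_nonempty[OF assms(2)]
    using assms by (intro sum.UNION_disjoint) auto
  also have "\<dots> = (\<Sum>x\<in>B. \<Sum>zs\<in>permutations_of_set (B - {x}). f (x # zs))"
    by (intro sum.cong[OF refl] sum.reindex[THEN trans]) auto
  finally show ?thesis .
qed

text \<open>The first letter is inverted with exactly the smaller letters, in whatever order these
  follow, so its weight can be pulled out of the sum over the remaining word.\<close>

lemma sum_list_inv_Cons:
  fixes B :: "'a::linorder set" and q :: real
  assumes "finite B" "B \<noteq> {}"
  shows "(\<Sum>zs\<in>permutations_of_set B. if P zs then q ^ list_inv zs else 0)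
    = (\<Sum>x\<in>B. q ^ card {y \<in> B. y < x} *
        (\<Sum>zs\<in>permutations_of_set (B - {x}). if P (x # zs) then q ^ list_inv zs else 0))"
proof -
  have *: "{y \<in> set zs. y < x} = {y \<in> B. y < x}" if "zs \<in> permutations_of_set (B - {x})" for x zs
    using permutations_of_setD(1)[OF that] by auto
  show ?thesis
    unfolding sum_permutations_of_set_Cons[OF assms] sum_distrib_left
    by (intro sum.cong refl) (auto simp: * power_add)
qed

lemma sum_list_inv:
  fixes B :: "'a::linorder set" and q :: real
  assumes "finite B"
  shows "(\<Sum>zs\<in>permutations_of_set B. q ^ list_inv zs) = qfact q (card B)"
  using assms
proof (induction "card B" arbitrary: B)
  case 0
  then show ?case by simp
next
  case (Suc n)
  then have "B \<noteq> {}" by auto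
  have "(\<Sum>zs\<in>permutations_of_set (B - {x}). q ^ list_inv zs) = qfact q n" if "x \<in> B" for x
    using Suc that by (metis card_Diff_singleton diff_Suc_1 finite_Diff)
  then have "(\<Sum>zs\<in>permutations_of_set B. q ^ list_inv zs)
      = (\<Sum>x\<in>B. q ^ card {y \<in> B. y < x} * qfact q n)"
    using sum_list_inv_Cons[OF Suc(3) \<open>B \<noteq> {}\<close>, of "\<lambda>_. True" q] by simp
  also have "\<dots> = qint q (Suc n) * qfact q n"
    using Suc sum_rank_power[of B q] by (simp flip: sum_distrib_right)
  finally show ?case using Suc by (metis qfact_Suc)
qed

text \<open>A permutation matrix cut after a given row and column into four blocks with
  \<open>\<alpha>\<close>, \<open>\<beta>\<close>, \<open>\<gamma>\<close>, \<open>\<delta>\<close> ones.\<close>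

definition block_weight :: "real \<Rightarrow> nat \<Rightarrow> nat \<Rightarrow> nat \<Rightarrow> nat \<Rightarrow> real" where
  "block_weight q \<alpha> \<beta> \<gamma> \<delta> = q ^ (\<beta> * \<gamma>) * qfact q (\<alpha> + \<beta>) * qfact q (\<gamma> + \<delta>) * qfact q (\<alpha> + \<gamma>) * qfact q (\<beta> + \<delta>)
     / (qfact q \<alpha> * qfact q \<beta> * qfact q \<gamma> * qfact q \<delta>)"

text \<open>This is \<open>qint_add\<close> for \<alpha> + \<beta>, multiplied by the common factor
  \<open>K\<close>. The two summands correspond to the one in the first row lying among the low or
  among the high columns.\<close>

lemma block_weight_rec:
  assumes q: "0 < q" and pos: "0 < \<alpha> + \<beta>"
  shows "block_weight q \<alpha> \<beta> \<gamma> \<delta>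
    = (if \<alpha> = 0 then 0 else qint q (\<alpha> + \<gamma>) * block_weight q (\<alpha> - 1) \<beta> \<gamma> \<delta>)
    + (if \<beta> = 0 then 0 else q ^ (\<alpha> + \<gamma>) * qint q (\<beta> + \<delta>) * block_weight q \<alpha> (\<beta> - 1) \<gamma> \<delta>)"
proof -
  define K where "K = q ^ (\<beta> * \<gamma>) * qfact q (\<alpha> + \<beta> - 1) * qfact q (\<gamma> + \<delta>) * qfact q (\<alpha> + \<gamma>) * qfact q (\<beta> + \<delta>)
     / (qfact q \<alpha> * qfact q \<beta> * qfact q \<gamma> * qfact q \<delta>)"
  have nz: "qfact q n \<noteq> 0" for n using qfact_pos[OF q, of n] by simp
  have ni: "qint q (Suc n) \<noteq> 0" for n using qint_pos[OF q, of "Suc n"] by simp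
  have "qfact q (\<alpha> + \<beta>) = qint q (\<alpha> + \<beta>) * qfact q (\<alpha> + \<beta> - 1)"
    using pos qfact_Suc[of q "\<alpha> + \<beta> - 1"] by simp
  then have 1: "block_weight q \<alpha> \<beta> \<gamma> \<delta> = K * (qint q \<alpha> + q ^ \<alpha> * qint q \<beta>)"
    unfolding block_weight_def K_def qint_add[symmetric] by (simp only:) (simp add: algebra_simps)
  have 2: "(if \<alpha> = 0 then 0 else qint q (\<alpha> + \<gamma>) * block_weight q (\<alpha> - 1) \<beta> \<gamma> \<delta>) = K * qint q \<alpha>"
  proof (cases \<alpha>)
    case (Suc a)
    then show ?thesis
      using nz[of a] ni[of a] by (simp add: block_weight_def K_def qfact_Suc field_simps)
  qed (simp add: K_def)
  have 3: "(if \<beta> = 0 then 0 else q ^ (\<alpha> + \<gamma>) * qint q (\<beta> + \<delta>) * block_weight q \<alpha> (\<beta> - 1) \<gamma> \<delta>)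
      = K * (q ^ \<alpha> * qint q \<beta>)"
  proof (cases \<beta>)
    case (Suc b)
    then show ?thesis
      using nz[of b] ni[of b] by (simp add: block_weight_def K_def qfact_Suc field_simps power_add)
  qed (simp add: K_def)
  show ?thesis unfolding 1 2 3 by (simp add: algebra_simps)
qed

text \<open>The factor q^(\<beta>\<gamma>) in the result counts the forced inversions between the
  \<beta> early high letters and the \<gamma> late low ones. Reading one letter of the first part
  lowers \<alpha> or \<beta> by one and keeps \<gamma> and \<delta>, hence the induction on \<alpha>
  + \<beta>.\<close>

lemma sum_list_inv_split:
  fixes B :: "'a::linorder set" and q :: real
  assumes "0 < q" "finite B"
    and "card {x \<in> B. x < v} = \<alpha> + \<gamma>" "card {x \<in> B. \<not> x < v} = \<beta> + \<delta>"
  shows "(\<Sum>zs\<in>permutations_of_set B.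
      if length (filter (\<lambda>x. x < v) (take (\<alpha> + \<beta>) zs)) = \<alpha> then q ^ list_inv zs else 0)
    = block_weight q \<alpha> \<beta> \<gamma> \<delta>"
  using assms(2-)
proof (induction "\<alpha> + \<beta>" arbitrary: B \<alpha> \<beta>)
  case 0
  have "card B = card ({x \<in> B. x < v} \<union> {x \<in> B. \<not> x < v})"
    by (rule arg_cong[where f = card]) auto
  also have "\<dots> = card {x \<in> B. x < v} + card {x \<in> B. \<not> x < v}"
    using 0 by (intro card_Un_disjoint) auto
  finally have "card B = \<gamma> + \<delta>" using 0 by simp
  then show ?case
    using 0 qfact_pos[OF assms(1), of \<gamma>] qfact_pos[OF assms(1), of \<delta>]
    by (simp add: sum_list_inv block_weight_def)
next
  case (Suc n)
  let ?lo = "{x \<in> B. x < v}" and ?hi = "{x \<in> B. \<not> x < v}"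
  let ?S = "\<lambda>x. \<Sum>zs\<in>permutations_of_set (B - {x}).
      if length (filter (\<lambda>x. x < v) (take (\<alpha> + \<beta>) (x # zs))) = \<alpha> then q ^ list_inv zs else 0"
  have "B \<noteq> {}"
    using Suc(2,4,5) by (metis (no_types, lifting) add_is_0 card.empty empty_Collect_eq
        empty_iff nat.distinct(1))
  have lo: "?S x = (if \<alpha> = 0 then 0 else block_weight q (\<alpha> - 1) \<beta> \<gamma> \<delta>)" if "x \<in> ?lo" for x
  proof (cases \<alpha>)
    case 0
    then show ?thesis using that Suc(2) by (auto intro!: sum.neutral)
  next
    case (Suc a)
    have *: "{y \<in> B - {x}. y < v} = ?lo - {x}" "{y \<in> B - {x}. \<not> y < v} = ?hi" using that by auto
    show ?thesis
      using Suc.hyps(1)[of a \<beta> "B - {x}"] Suc Suc.hyps(2) Suc.prems that unfolding *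
      by simp
  qed
  have hi: "?S x = (if \<beta> = 0 then 0 else block_weight q \<alpha> (\<beta> - 1) \<gamma> \<delta>)" if "x \<in> ?hi" for x
  proof (cases \<beta>)
    case 0
    \<comment> \<open>With \<beta> = 0 all \<alpha> letters of the first part would have to be low,
      but its first letter x is high.\<close>
    then have "length (filter (\<lambda>x. x < v) (take (\<alpha> + \<beta>) (x # zs))) \<noteq> \<alpha>" for zs
      using that Suc(2) length_filter_le[of "\<lambda>x. x < v" "take n zs"] by (auto simp flip: Suc(2))
    then show ?thesis using 0 by (auto intro!: sum.neutral)
  next
    case (Suc b)
    have *: "{y \<in> B - {x}. y < v} = ?lo" "{y \<in> B - {x}. \<not> y < v} = ?hi - {x}" using that by auto
    show ?thesis
      using Suc.hyps(1)[of \<alpha> b "B - {x}"] Suc Suc.hyps(2) Suc.prems that unfolding *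
      by simp
  qed
  have "(\<Sum>zs\<in>permutations_of_set B.
      if length (filter (\<lambda>x. x < v) (take (\<alpha> + \<beta>) zs)) = \<alpha> then q ^ list_inv zs else 0)
      = (\<Sum>x\<in>B. q ^ card {y \<in> B. y < x} * ?S x)"
    by (rule sum_list_inv_Cons[OF Suc(3) \<open>B \<noteq> {}\<close>])
  also have "\<dots> = (\<Sum>x\<in>?lo \<union> ?hi. q ^ card {y \<in> B. y < x} * ?S x)"
    by (rule sum.cong) auto
  also have "\<dots> = (\<Sum>x\<in>?lo. q ^ card {y \<in> B. y < x} * ?S x) + (\<Sum>x\<in>?hi. q ^ card {y \<in> B. y < x} * ?S x)"
    using Suc(3) by (intro sum.union_disjoint) auto
  also have "(\<Sum>x\<in>?lo. q ^ card {y \<in> B. y < x} * ?S x)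
      = qint q (card ?lo) * (if \<alpha> = 0 then 0 else block_weight q (\<alpha> - 1) \<beta> \<gamma> \<delta>)"
    unfolding sum_rank_power_below[OF Suc(3), symmetric] sum_distrib_right
    by (rule sum.cong[OF refl]) (simp only: lo)
  also have "(\<Sum>x\<in>?hi. q ^ card {y \<in> B. y < x} * ?S x)
      = q ^ card ?lo * qint q (card ?hi) * (if \<beta> = 0 then 0 else block_weight q \<alpha> (\<beta> - 1) \<gamma> \<delta>)"
    unfolding sum_rank_power_above[OF Suc(3), symmetric] sum_distrib_right
    by (rule sum.cong[OF refl]) (simp only: hi)
  finally show ?case
    using Suc.hyps(2) Suc.prems by (subst block_weight_rec[OF assms(1)]) (auto simp: mult.assoc)
qed

text \<open>The letters before index k contribute at most their full factors \<open>qint\<close>. At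
  index k the sum over the possible letters, which would give \<open>qint q (card B - k)\<close>,
  shrinks to at most one power of q, hence to at most 1; the later letters are again bounded by
  their full factors.\<close>

lemma sum_list_inv_determined:
  fixes B :: "'a::linorder set" and q :: real
  assumes "0 < q" "q \<le> 1" "finite B" "k < card B"
    and "\<And>zs zs'. zs \<in> permutations_of_set B \<Longrightarrow> zs' \<in> permutations_of_set B \<Longrightarrow>
        P zs \<Longrightarrow> P zs' \<Longrightarrow> take k zs = take k zs' \<Longrightarrow> zs ! k = zs' ! k"
  shows "(\<Sum>zs\<in>permutations_of_set B. if P zs then q ^ list_inv zs else 0)
    \<le> qfact q (card B) / qint q (card B - k)"
  using assms(3-)
proof (induction k arbitrary: B P)
  case 0
  then have "B \<noteq> {}" by auto
  obtain n where n: "card B = Suc n" using 0 by (cases "card B") auto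
  have crd: "card (B - {x}) = n" if "x \<in> B" for x using that n 0 by simp
  let ?S = "\<lambda>x. \<Sum>zs\<in>permutations_of_set (B - {x}). if P (x # zs) then q ^ list_inv zs else 0"
  have S: "(\<Sum>zs\<in>permutations_of_set B. if P zs then q ^ list_inv zs else 0)
      = (\<Sum>x\<in>B. q ^ card {y \<in> B. y < x} * ?S x)"
    by (rule sum_list_inv_Cons) fact+
  have mem: "x # zs \<in> permutations_of_set B" if "x \<in> B" "zs \<in> permutations_of_set (B - {x})" for x zs
    using that by (auto simp: permutations_of_set_def)
  have "(\<Sum>x\<in>B. q ^ card {y \<in> B. y < x} * ?S x) \<le> qfact q n"
  proof (cases "\<exists>x\<in>B. \<exists>zs\<in>permutations_of_set (B - {x}). P (x # zs)")
    case True
    then obtain c zs where c: "c \<in> B" "zs \<in> permutations_of_set (B - {c})" "P (c # zs)" by auto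
    have "?S x = 0" if "x \<in> B - {c}" for x
    proof (rule sum.neutral, rule ballI)
      fix ys assume "ys \<in> permutations_of_set (B - {x})"
      then show "(if P (x # ys) then q ^ list_inv ys else 0) = 0"
        using 0(3)[OF mem[OF c(1,2)] mem[of x ys] c(3)] that by auto
    qed
    then have "(\<Sum>x\<in>B. q ^ card {y \<in> B. y < x} * ?S x) = q ^ card {y \<in> B. y < c} * ?S c"
      using c(1) 0(1) by (subst sum.remove[of _ c]) (auto intro!: sum.neutral)
    also have "\<dots> \<le> 1 * ?S c"
      using assms(1,2) by (intro mult_right_mono power_le_one sum_nonneg) auto
    also have "?S c \<le> (\<Sum>zs\<in>permutations_of_set (B - {c}). q ^ list_inv zs)"
      using assms(1) by (intro sum_mono) auto
    also have "\<dots> = qfact q n" using 0 crd[OF c(1)] by (simp add: sum_list_inv)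
    finally show ?thesis by simp
  next
    case False
    then have "(\<Sum>x\<in>B. q ^ card {y \<in> B. y < x} * ?S x) = 0"
      by (intro sum.neutral ballI) (auto intro!: sum.neutral)
    then show ?thesis using qfact_pos[OF assms(1), of n] by simp
  qed
  also have "\<dots> = qfact q (card B) / qint q (card B - 0)"
    using n qint_pos[OF assms(1), of "Suc n"] by (simp add: qfact_Suc)
  finally show ?case unfolding S .
next
  case (Suc k)
  then have "B \<noteq> {}" by auto
  obtain n where n: "card B = Suc n" using Suc by (cases "card B") auto
  have "k < n" using Suc n by simp
  let ?S = "\<lambda>x. \<Sum>zs\<in>permutations_of_set (B - {x}). if P (x # zs) then q ^ list_inv zs else 0"
  have mem: "x # zs \<in> permutations_of_set B" if "x \<in> B" "zs \<in> permutations_of_set (B - {x})" for x zs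
    using that by (auto simp: permutations_of_set_def)
  have "?S x \<le> qfact q n / qint q (n - k)" if "x \<in> B" for x
  proof -
    have crd: "card (B - {x}) = n" using that n Suc by simp
    have "?S x \<le> qfact q (card (B - {x})) / qint q (card (B - {x}) - k)"
    proof (rule Suc.IH)
      fix zs zs' assume "zs \<in> permutations_of_set (B - {x})" "zs' \<in> permutations_of_set (B - {x})"
        "P (x # zs)" "P (x # zs')" "take k zs = take k zs'"
      then show "zs ! k = zs' ! k"
        using Suc.prems(3)[of "x # zs" "x # zs'"] mem[OF \<open>x \<in> B\<close>] by simp
    qed (use Suc.prems(1) \<open>k < n\<close> crd in simp_all)
    then show ?thesis unfolding crd .
  qed
  then have "(\<Sum>x\<in>B. q ^ card {y \<in> B. y < x} * ?S x)
      \<le> (\<Sum>x\<in>B. q ^ card {y \<in> B. y < x} * (qfact q n / qint q (n - k)))"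
    using assms(1) by (intro sum_mono mult_left_mono) auto
  also have "\<dots> = qint q (card B) * (qfact q n / qint q (n - k))"
    by (simp only: sum_rank_power[OF Suc(2)] sum_distrib_right[symmetric])
  also have "\<dots> = qfact q (card B) / qint q (card B - Suc k)"
    using n by (simp add: qfact_Suc)
  finally show ?case
    unfolding sum_list_inv_Cons[OF Suc(2) \<open>B \<noteq> {}\<close>] .
qed

section \<open>Permutations of an interval and their cuts\<close>

lemma list_inv_map_sorted:
  assumes "sorted_wrt (<) xs" "inj_on p (set xs)"
  shows "list_inv (map p xs) = inv_count (set xs) p"
  using assms
proof (induction xs)
  case Nil
  then show ?case by (simp add: inv_count_def)
next
  case (Cons x xs)
  let ?S = "set xs"
  have x: "x < y" if "y \<in> ?S" for y using that Cons by auto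
  have "{(i, j). i \<in> insert x ?S \<and> j \<in> insert x ?S \<and> i < j \<and> p i > p j}
      = Pair x ` {j \<in> ?S. p j < p x} \<union> {(i, j). i \<in> ?S \<and> j \<in> ?S \<and> i < j \<and> p i > p j}"
    using x by force
  moreover have "finite {(i, j). i \<in> ?S \<and> j \<in> ?S \<and> i < j \<and> p i > p j}"
    by (rule finite_subset[of _ "?S \<times> ?S"]) auto
  moreover have "Pair x ` {j \<in> ?S. p j < p x} \<inter> {(i, j). i \<in> ?S \<and> j \<in> ?S \<and> i < j \<and> p i > p j} = {}"
    using x by force
  ultimately have "inv_count (insert x ?S) p = card (Pair x ` {j \<in> ?S. p j < p x}) + inv_count ?S p"
    unfolding inv_count_def by (simp add: card_Un_disjoint)
  also have "card (Pair x ` {j \<in> ?S. p j < p x}) = card {j \<in> ?S. p j < p x}"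
    by (intro card_image) (auto intro: inj_onI)
  also have "{y \<in> p ` ?S. y < p x} = p ` {j \<in> ?S. p j < p x}" by auto
  then have "card {j \<in> ?S. p j < p x} = card {y \<in> p ` ?S. y < p x}"
    using Cons(3) by (metis (no_types, lifting) card_image inj_on_subset mem_Collect_eq set_subset_Cons subsetI)
  finally show ?case using Cons by simp
qed

lemma bij_betw_permutes_lists:
  assumes "set xs = S" "distinct xs"
  shows "bij_betw (\<lambda>p. map p xs) {p. p permutes S} (permutations_of_set S)"
proof -
  have inj: "inj_on (\<lambda>p. map p xs) {p. p permutes S}"
  proof (rule inj_onI, rule ext)
    fix p p' x assume "p \<in> {p. p permutes S}" "p' \<in> {p. p permutes S}" "map p xs = map p' xs"
    then show "p x = p' x" using assms(1) by (cases "x \<in> S") (auto simp: permutes_not_in)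
  qed
  have sub: "(\<lambda>p. map p xs) ` {p. p permutes S} \<subseteq> permutations_of_set S"
  proof safe
    fix p assume p: "p permutes S"
    show "map p xs \<in> permutations_of_set S"
      using assms p permutes_image[OF p]
      by (auto simp: permutations_of_set_def distinct_map intro: permutes_inj_on)
  qed
  have "finite S" using assms by auto
  then have "card ((\<lambda>p. map p xs) ` {p. p permutes S}) = card (permutations_of_set S)"
    by (simp add: card_image[OF inj] card_permutations)
  with sub inj show ?thesis
    by (simp add: bij_betw_def card_subset_eq)
qed

lemma sum_permutes_lists:
  fixes f :: "int list \<Rightarrow> real"
  shows "(\<Sum>p | p permutes {a..b}. f (map p [a..b])) = (\<Sum>zs\<in>permutations_of_set {a..b}. f zs)"
  by (rule sum.reindex_bij_betw[OF bij_betw_permutes_lists]) auto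

lemma sorted_wrt_less_upto: "sorted_wrt (<) [a..b]"
  by (auto simp: sorted_wrt_iff_nth_less)

lemma list_inv_map_upto: "p permutes {a..b} \<Longrightarrow> list_inv (map p [a..b]) = inv_count {a..b} p"
  using list_inv_map_sorted[OF sorted_wrt_less_upto[of a b], of p] by (simp add: permutes_inj_on)

lemma sum_inv_count_lists:
  fixes q :: real
  shows "(\<Sum>p | p permutes {a..b}. if P (map p [a..b]) then q ^ inv_count {a..b} p else 0)
    = (\<Sum>zs\<in>permutations_of_set {a..b}. if P zs then q ^ list_inv zs else 0)"
  unfolding sum_permutes_lists[symmetric] by (intro sum.cong) (auto simp: list_inv_map_upto)

lemma sum_inv_count: "(\<Sum>p | p permutes {a..b}. q ^ inv_count {a..b} p) = qfact q (nat (b - a + 1))"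
  using sum_inv_count_lists[where P = "\<lambda>_. True"] by (simp add: sum_list_inv)

text \<open>Quantifying over all integers up to c makes the notion independent of the interval that
  is permuted; in particular both ends of that interval count as cuts. One inclusion is enough,
  since an injection of a finite set into itself is onto.\<close>

definition is_cut :: "(int \<Rightarrow> int) \<Rightarrow> int \<Rightarrow> bool" where
  "is_cut p c \<longleftrightarrow> (\<forall>x\<le>c. p x \<le> c)"

lemma permutes_image_below_cut:
  assumes p: "p permutes {l..r}" and c: "is_cut p c" "c \<le> r"
  shows "p ` {l..c} = {l..c}"
proof (rule endo_inj_surj)
  show "p ` {l..c} \<subseteq> {l..c}"
  proof safe
    fix x assume "x \<in> {l..c}"
    then have "p x \<in> {l..r}" "p x \<le> c"
      using c permutes_in_image[OF p, of x] by (auto simp: is_cut_def)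
    then show "p x \<in> {l..c}" by auto
  qed
qed (use p in \<open>auto intro: permutes_inj_on\<close>)

lemma permutes_image_above_cut:
  assumes p: "p permutes {l..r}" and c: "is_cut p c" "c \<le> r" "l \<le> c + 1"
  shows "p ` {c + 1..r} = {c + 1..r}"
proof -
  have "{c + 1..r} = {l..r} - {l..c}" using c by auto
  then show ?thesis
    using image_set_diff[OF permutes_inj[OF p], of "{l..r}" "{l..c}"] permutes_image[OF p]
      permutes_image_below_cut[OF p c(1,2)] by simp
qed

lemma comp_permutes_intervals:
  fixes c :: int
  assumes p1: "p1 permutes {l..c}" and p2: "p2 permutes {c + 1..r}"
  shows "(p1 \<circ> p2) x = (if x \<le> c then p1 x else p2 x)"
proof (cases "x \<le> c")
  case True
  then have "x \<notin> {c + 1..r}" by auto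
  then have "p2 x = x" by (rule permutes_not_in[OF p2])
  then show ?thesis using True by simp
next
  case False
  then have "\<not> p2 x \<le> c"
    using permutes_in_image[OF p2, of x] permutes_not_in[OF p2, of x] by (cases "x \<in> {c + 1..r}") auto
  then show ?thesis using False permutes_not_in[OF p1, of "p2 x"] by simp
qed

lemma permutes_le_iff: "p permutes {l..c} \<Longrightarrow> p x \<le> c \<longleftrightarrow> x \<le> c" for c :: int
  using permutes_in_image[of p "{l..c}" x] permutes_not_in[of p "{l..c}" x]
  by (cases "x \<in> {l..c}") auto

lemma permutes_ge_iff: "p permutes {l..c} \<Longrightarrow> l \<le> p x \<longleftrightarrow> l \<le> x" for c :: int
  using permutes_in_image[of p "{l..c}" x] permutes_not_in[of p "{l..c}" x]
  by (cases "x \<in> {l..c}") auto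

text \<open>The bounds on c admit an empty left part (c = l - 1) and an empty right part (c = r);
  these occur when the block of 0 reaches an end of the window.\<close>

lemma bij_betw_cut:
  assumes lr: "l \<le> c + 1" "c \<le> r"
  shows "bij_betw (\<lambda>(p1, p2). p1 \<circ> p2) ({p. p permutes {l..c}} \<times> {p. p permutes {c + 1..r}})
    {p. p permutes {l..r} \<and> is_cut p c}"
proof (rule bij_betw_byWitness[where f' = "\<lambda>p. (\<lambda>x. if x \<le> c then p x else x, \<lambda>x. if x \<le> c then x else p x)"],
    goal_cases)
  case 1
  show ?case
  proof (safe, goal_cases)
    case (1 p1 p2)
    show ?case
      using permutes_not_in[OF 1(1)] unfolding comp_permutes_intervals[OF 1] by force
  next
    case (2 p1 p2)
    show ?case
      using permutes_not_in[OF 2(2)] unfolding comp_permutes_intervals[OF 2] by force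
  qed
next
  case 2
  show ?case
  proof (safe, rule ext, goal_cases)
    case (1 p x)
    have "\<not> p x \<le> c" if "\<not> x \<le> c"
    proof (cases "x \<in> {l..r}")
      case True
      then show ?thesis using permutes_image_above_cut[OF 1(1) 1(2) lr(2,1)] that
        imageI[of x "{c + 1..r}" p] by auto
    next
      case False
      then show ?thesis using permutes_not_in[OF 1(1)] that by auto
    qed
    then show ?case by auto
  qed
next
  case 3
  show ?case
  proof (safe, goal_cases)
    case (1 _ p1 p2)
    have "{l..c} \<subseteq> {l..r}" "{c + 1..r} \<subseteq> {l..r}" using lr by auto
    then show ?case
      using 1 by (auto intro!: permutes_compose intro: permutes_subset)
  next
    case (2 _ p1 p2)
    show ?case
      unfolding is_cut_def comp_permutes_intervals[OF 2]
      using permutes_le_iff[OF 2(1)] by auto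
  qed
next
  case 4
  have "(\<lambda>x. if x \<le> c then p x else x) permutes {l..c} \<and>
      (\<lambda>x. if x \<le> c then x else p x) permutes {c + 1..r}"
    if p: "p permutes {l..r}" "is_cut p c" for p
  proof
    have "bij_betw (\<lambda>x. if x \<le> c then p x else x) {l..c} {l..c}"
      using permutes_image_below_cut[OF p lr(2)] permutes_inj_on[OF p(1)]
      by (subst bij_betw_cong[where g = p]) (auto simp: bij_betw_def)
    then show "(\<lambda>x. if x \<le> c then p x else x) permutes {l..c}"
      using permutes_not_in[OF p(1)] lr by (intro bij_imp_permutes) auto
    have "bij_betw (\<lambda>x. if x \<le> c then x else p x) {c + 1..r} {c + 1..r}"
      using permutes_image_above_cut[OF p lr(2,1)] permutes_inj_on[OF p(1)]
      by (subst bij_betw_cong[where g = p]) (auto simp: bij_betw_def)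
    then show "(\<lambda>x. if x \<le> c then x else p x) permutes {c + 1..r}"
      using permutes_not_in[OF p(1)] lr by (intro bij_imp_permutes) auto
  qed
  then show ?case by auto
qed

lemma sum_cut:
  fixes f :: "(int \<Rightarrow> int) \<Rightarrow> real"
  assumes "l \<le> c + 1" "c \<le> r"
  shows "(\<Sum>p | p permutes {l..r} \<and> is_cut p c. f p)
    = (\<Sum>p1 | p1 permutes {l..c}. \<Sum>p2 | p2 permutes {c + 1..r}. f (p1 \<circ> p2))"
  unfolding sum.cartesian_product sum.reindex_bij_betw[OF bij_betw_cut[OF assms], symmetric]
  by (intro sum.cong) auto

text \<open>Neither factor moves a point across c, so a pair on different sides of the cut is never
  inverted. This makes the weight multiplicative over cuts.\<close>

lemma inv_count_comp:
  assumes "l \<le> c + 1" "c \<le> r" and p1: "p1 permutes {l..c}" and p2: "p2 permutes {c + 1..r}"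
  shows "inv_count {l..r} (p1 \<circ> p2) = inv_count {l..c} p1 + inv_count {c + 1..r} p2"
proof -
  let ?p = "p1 \<circ> p2"
  let ?I = "\<lambda>A p. {(i, j). i \<in> A \<and> j \<in> A \<and> i < j \<and> p i > (p j :: int)}"
  have fin: "finite (?I A p)" if "finite A" for A p
    by (rule finite_subset[of _ "A \<times> A"]) (use that in auto)
  have le: "p1 x \<le> c \<longleftrightarrow> x \<le> c" for x by (rule permutes_le_iff) fact
  have ge: "c + 1 \<le> p2 x \<longleftrightarrow> c + 1 \<le> x" for x by (rule permutes_ge_iff) fact
  have "(i, j) \<in> ?I {l..r} ?p \<longleftrightarrow> (i, j) \<in> ?I {l..c} p1 \<union> ?I {c + 1..r} p2" for i j
    using le[of i] le[of j] ge[of i] ge[of j] assms(1,2)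
    unfolding mem_Collect_eq prod.case Un_iff comp_permutes_intervals[OF p1 p2]
    by (cases "i \<le> c"; cases "j \<le> c") auto
  then have "?I {l..r} ?p = ?I {l..c} p1 \<union> ?I {c + 1..r} p2" by auto
  moreover have "?I {l..c} p1 \<inter> ?I {c + 1..r} p2 = {}" by auto
  ultimately show ?thesis
    unfolding inv_count_def using fin[of "{l..c}" p1] fin[of "{c + 1..r}" p2]
    by (simp only: card_Un_disjoint finite_atLeastAtMost_int simp_thms)
qed

lemma funpow_cong_on:
  assumes "x \<in> S" "\<And>y. y \<in> S \<Longrightarrow> g y \<in> S" "\<And>y. y \<in> S \<Longrightarrow> f y = g y"
  shows "(f ^^ k) x = (g ^^ k) x \<and> (g ^^ k) x \<in> S"
  by (induction k) (use assms in auto)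

lemma orb_cong:
  assumes "x \<in> S" "\<And>y. y \<in> S \<Longrightarrow> g y \<in> S" "\<And>y. y \<in> S \<Longrightarrow> f y = g y"
  shows "orb f x = orb g x"
  using funpow_cong_on[OF assms] by (simp add: orb_def)

lemma
  assumes p1: "p1 permutes {l..c}" and p2: "p2 permutes {c + 1..r}"
  shows cut_comp_above: "c \<le> d \<Longrightarrow> is_cut (p1 \<circ> p2) d \<longleftrightarrow> is_cut p2 d"
    and cut_comp_below: "d \<le> c \<Longrightarrow> is_cut (p1 \<circ> p2) d \<longleftrightarrow> is_cut p1 d"
    and orb_comp_above: "c < x \<Longrightarrow> orb (p1 \<circ> p2) x = orb p2 x"
    and orb_comp_below: "x \<le> c \<Longrightarrow> orb (p1 \<circ> p2) x = orb p1 x"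
proof -
  have le: "p1 x \<le> c \<longleftrightarrow> x \<le> c" for x by (rule permutes_le_iff) fact
  have ge: "c + 1 \<le> p2 x \<longleftrightarrow> c + 1 \<le> x" for x by (rule permutes_ge_iff) fact
  have below: "p2 x = x" if "x \<le> c" for x using permutes_not_in[OF p2, of x] that by auto
  note comp = comp_permutes_intervals[OF p1 p2]
  show "is_cut (p1 \<circ> p2) d \<longleftrightarrow> is_cut p2 d" if "c \<le> d"
  proof -
    have "(p1 \<circ> p2) x \<le> d \<longleftrightarrow> p2 x \<le> d" if "x \<le> d" for x
      using le[of x] \<open>c \<le> d\<close> below[of x] that unfolding comp by auto
    then show ?thesis by (simp add: is_cut_def)
  qed
  show "is_cut (p1 \<circ> p2) d \<longleftrightarrow> is_cut p1 d" if "d \<le> c"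
    using that unfolding is_cut_def comp by auto
  show "orb (p1 \<circ> p2) x = orb p2 x" if "c < x"
  proof (rule orb_cong[where S = "{c + 1..}"])
    fix y assume y: "y \<in> {c + 1..}"
    then show "p2 y \<in> {c + 1..}" using ge[of y] by simp
    show "(p1 \<circ> p2) y = p2 y" unfolding comp using y by simp
  qed (use that in auto)
  show "orb (p1 \<circ> p2) x = orb p1 x" if "x \<le> c"
    by (rule orb_cong[where S = "{..c}"]) (use that le comp in auto)
qed

text \<open>The permutations of \<open>{-s..t}\<close> that can be the block around \<open>0\<close>: no cut strictly inside separates
  \<open>0\<close> from an end of the interval.\<close>

definition irreducible_perms :: "nat \<Rightarrow> nat \<Rightarrow> (int \<Rightarrow> int) set" where
  "irreducible_perms s t = {p. p permutes {- int s..int t} \<and>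
     (\<forall>s'<s. \<not> is_cut p (- int s' - 1)) \<and> (\<forall>t'<t. \<not> is_cut p (int t'))}"

definition block_sum :: "real \<Rightarrow> (int set \<Rightarrow> real) \<Rightarrow> nat \<Rightarrow> nat \<Rightarrow> real" where
  "block_sum q \<phi> s t = (\<Sum>p\<in>irreducible_perms s t. \<phi> (orb p 0) * q ^ inv_count {- int s..int t} p)"

lemma finite_irreducible_perms [simp]: "finite (irreducible_perms s t)"
  unfolding irreducible_perms_def by (rule finite_subset[OF _ finite_permutations[of "{- int s..int t}"]]) auto

text \<open>Cutting at -s-1 and then at t leaves three independent parts. The orbit of 0 and the
  minimality of s and t depend on the middle part only, so the two outer sums are unrestricted and
  give q-factorials.\<close>

lemma sum_block:
  assumes st: "s \<le> a" "t \<le> b"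
  shows "(\<Sum>p | p permutes {- int a..int b} \<and> is_cut p (- int s - 1) \<and> is_cut p (int t)
        \<and> (\<forall>s'<s. \<not> is_cut p (- int s' - 1)) \<and> (\<forall>t'<t. \<not> is_cut p (int t')).
        \<phi> (orb p 0) * q ^ inv_count {- int a..int b} p)
    = qfact q (a - s) * qfact q (b - t) * block_sum q \<phi> s t" (is "?lhs = _")
proof -
  let ?irr = "\<lambda>p. (\<forall>s'<s. \<not> is_cut p (- int s' - 1)) \<and> (\<forall>t'<t. \<not> is_cut p (int t'))"
  let ?g = "\<lambda>p. \<phi> (orb p 0) * q ^ inv_count {- int s..int b} p"
  let ?h = "\<lambda>p. \<phi> (orb p 0) * q ^ inv_count {- int s..int t} p"
  let ?f = "\<lambda>p. \<phi> (orb p 0) * q ^ inv_count {- int a..int b} p"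
  have fin: "finite {p. p permutes {l..r}}" for l r :: int by (rule finite_permutations) simp
  have fin': "finite {p. p permutes {l..r} \<and> Q p}" for l r :: int and Q
    by (rule finite_subset[OF _ fin[of l r]]) auto
  have L: "- int a \<le> (- int s - 1) + 1" "- int s - 1 \<le> int b" using st by auto
  have "?lhs = (\<Sum>p | p permutes {- int a..int b} \<and> is_cut p (- int s - 1). if is_cut p (int t) \<and> ?irr p then ?f p else 0)"
    by (subst sum.inter_filter[symmetric]) (auto intro!: fin' sum.cong)
  also have "\<dots> = (\<Sum>p1 | p1 permutes {- int a..- int s - 1}. \<Sum>p2 | p2 permutes {(- int s - 1) + 1..int b}.
      if is_cut (p1 \<circ> p2) (int t) \<and> ?irr (p1 \<circ> p2) then ?f (p1 \<circ> p2) else 0)"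
    by (rule sum_cut[OF L])
  also have "\<dots> = (\<Sum>p1 | p1 permutes {- int a..- int s - 1}. \<Sum>p2 | p2 permutes {(- int s - 1) + 1..int b}.
      q ^ inv_count {- int a..- int s - 1} p1 * (if is_cut p2 (int t) \<and> ?irr p2 then ?g p2 else 0))"
  proof (intro sum.cong refl, goal_cases)
    case (1 p1 p2)
    then have p: "p1 permutes {- int a..- int s - 1}" "p2 permutes {(- int s - 1) + 1..int b}" by auto
    have "is_cut (p1 \<circ> p2) (int t) \<longleftrightarrow> is_cut p2 (int t)" for t
      by (rule cut_comp_above[OF p]) simp
    moreover have "is_cut (p1 \<circ> p2) (- int s' - 1) \<longleftrightarrow> is_cut p2 (- int s' - 1)" if "s' < s" for s'
      by (rule cut_comp_above[OF p]) (use that in simp)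
    moreover have "orb (p1 \<circ> p2) 0 = orb p2 0"
      by (rule orb_comp_above[OF p]) simp
    moreover have "inv_count {- int a..int b} (p1 \<circ> p2)
        = inv_count {- int a..- int s - 1} p1 + inv_count {- int s..int b} p2"
      using inv_count_comp[OF L p] by simp
    ultimately show ?case by (auto simp: power_add)
  qed
  also have "\<dots> = qfact q (a - s) * (\<Sum>p2 | p2 permutes {- int s..int b}. if is_cut p2 (int t) \<and> ?irr p2 then ?g p2 else 0)"
  proof -
    have "nat (- int s - 1 - - int a + 1) = a - s" using st by linarith
    then show ?thesis
      using sum_inv_count[of q "- int a" "- int s - 1"]
      by (simp flip: sum_distrib_left sum_distrib_right)
  qed
  also have "(\<Sum>p2 | p2 permutes {- int s..int b}. if is_cut p2 (int t) \<and> ?irr p2 then ?g p2 else 0)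
     = (\<Sum>p2 | p2 permutes {- int s..int b} \<and> is_cut p2 (int t). if ?irr p2 then ?g p2 else 0)"
    using sum.inter_filter[OF fin[of "- int s" "int b"], of "\<lambda>p. if ?irr p then ?g p else 0" "\<lambda>p. is_cut p (int t)"]
    by (simp add: if_if_eq_conj Collect_conj_eq[symmetric] del: Collect_conj_eq cong: if_cong)
  also have "\<dots> = (\<Sum>p1 | p1 permutes {- int s..int t}. \<Sum>p2 | p2 permutes {int t + 1..int b}.
      if ?irr (p1 \<circ> p2) then ?g (p1 \<circ> p2) else 0)"
    by (rule sum_cut) (use st in auto)
  also have "\<dots> = (\<Sum>p1 | p1 permutes {- int s..int t}. \<Sum>p2 | p2 permutes {int t + 1..int b}.
      (if ?irr p1 then ?h p1 else 0) * q ^ inv_count {int t + 1..int b} p2)"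
  proof (intro sum.cong refl, goal_cases)
    case (1 p1 p2)
    then have p: "p1 permutes {- int s..int t}" "p2 permutes {int t + 1..int b}" by auto
    have "is_cut (p1 \<circ> p2) (int t') \<longleftrightarrow> is_cut p1 (int t')" if "t' < t" for t'
      by (rule cut_comp_below[OF p]) (use that in simp)
    moreover have "is_cut (p1 \<circ> p2) (- int s' - 1) \<longleftrightarrow> is_cut p1 (- int s' - 1)" for s'
      by (rule cut_comp_below[OF p]) simp
    moreover have "orb (p1 \<circ> p2) 0 = orb p1 0"
      by (rule orb_comp_below[OF p]) simp
    moreover have "inv_count {- int s..int b} (p1 \<circ> p2)
        = inv_count {- int s..int t} p1 + inv_count {int t + 1..int b} p2"
      by (rule inv_count_comp[OF _ _ p]) (use st in auto)
    ultimately show ?case by (auto simp: power_add)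
  qed
  also have "\<dots> = qfact q (b - t) * (\<Sum>p1 | p1 permutes {- int s..int t}. if ?irr p1 then ?h p1 else 0)"
  proof -
    have "nat (int b - (int t + 1) + 1) = b - t" using st by linarith
    then show ?thesis
      using sum_inv_count[of q "int t + 1" "int b"]
      by (simp flip: sum_distrib_left sum_distrib_right)
  qed
  also have "(\<Sum>p1 | p1 permutes {- int s..int t}. if ?irr p1 then ?h p1 else 0) = block_sum q \<phi> s t"
    unfolding block_sum_def irreducible_perms_def
    using sum.inter_filter[OF fin[of "- int s" "int t"], of ?h ?irr] by simp
  finally show ?thesis by simp
qed

lemma sum_permutes_blocks:
  "(\<Sum>p | p permutes {- int a..int b}. \<phi> (orb p 0) * q ^ inv_count {- int a..int b} p)
    = (\<Sum>(s, t)\<in>{..a} \<times> {..b}. qfact q (a - s) * qfact q (b - t) * block_sum q \<phi> s t)"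
proof -
  let ?S = "{p. p permutes {- int a..int b}}"
  let ?f = "\<lambda>p. \<phi> (orb p 0) * q ^ inv_count {- int a..int b} p"
  define left right where "left p = (LEAST s. is_cut p (- int s - 1))" and "right p = (LEAST t. is_cut p (int t))"
    for p
  \<comment> \<open>The ends of the window are always cuts; hence the least s and t exist and are at
    most a and b.\<close>
  have ca: "is_cut p (- int a - 1)" and cb: "is_cut p (int b)" if "p permutes {- int a..int b}" for p
    using permutes_le_iff[OF that] permutes_not_in[OF that] by (auto simp: is_cut_def)
  have fin: "finite ?S" by (rule finite_permutations) simp
  have "(\<lambda>p. (left p, right p)) ` ?S \<subseteq> {..a} \<times> {..b}"
    using ca cb by (auto simp: left_def right_def intro: Least_le)
  from sum.group[OF fin _ this, of ?f]
  have "(\<Sum>p\<in>?S. ?f p) = (\<Sum>st\<in>{..a} \<times> {..b}. \<Sum>p | p \<in> ?S \<and> (left p, right p) = st. ?f p)"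
    by simp
  also have "\<dots> = (\<Sum>(s, t)\<in>{..a} \<times> {..b}. qfact q (a - s) * qfact q (b - t) * block_sum q \<phi> s t)"
  proof (rule sum.cong[OF refl])
    fix st assume "st \<in> {..a} \<times> {..b}"
    then obtain s t where eq: "st = (s, t)" and st: "s \<in> {..a}" "t \<in> {..b}" by auto
    have "left p = s \<longleftrightarrow> is_cut p (- int s - 1) \<and> (\<forall>s'<s. \<not> is_cut p (- int s' - 1))"
      if "p permutes {- int a..int b}" for p
      unfolding left_def using LeastI[of "\<lambda>s. is_cut p (- int s - 1)", OF ca[OF that]]
      by (metis (no_types, lifting) Least_equality linorder_not_less not_less_Least)
    moreover have "right p = t \<longleftrightarrow> is_cut p (int t) \<and> (\<forall>t'<t. \<not> is_cut p (int t'))"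
      if "p permutes {- int a..int b}" for p
      unfolding right_def using LeastI[of "\<lambda>s. is_cut p (int s)", OF cb[OF that]]
      by (metis (no_types, lifting) Least_equality linorder_not_less not_less_Least)
    ultimately have "{p \<in> ?S. (left p, right p) = (s, t)}
      = {p. p permutes {- int a..int b} \<and> is_cut p (- int s - 1) \<and> is_cut p (int t)
        \<and> (\<forall>s'<s. \<not> is_cut p (- int s' - 1)) \<and> (\<forall>t'<t. \<not> is_cut p (int t'))}"
      by auto
    then show "(\<Sum>p | p \<in> ?S \<and> (left p, right p) = st. ?f p)
        = (case st of (s, t) \<Rightarrow> qfact q (a - s) * qfact q (b - t) * block_sum q \<phi> s t)"
      using sum_block[of s a t b \<phi> q] st unfolding eq by simp
  qed
  finally show ?thesis by simp
qed

section \<open>Limits of local orbit statistics\<close>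

lemma suminf_tendsto_dominated:
  fixes a :: "nat \<Rightarrow> 'b \<Rightarrow> real"
  assumes "\<And>k. (a k \<longlongrightarrow> b k) F" "\<And>k x. norm (a k x) \<le> M k" "summable M" "F \<noteq> bot"
  shows "((\<lambda>x. \<Sum>k. a k x) \<longlongrightarrow> (\<Sum>k. b k)) F"
  using tannerys_theorem[of a b F M] assms by (auto intro: always_eventually)

text \<open>The q-Pochhammer symbol (q; q)_n, the product of 1 - q^j for j = 1..n. The power of 1 -
  q turns the q-factorial into a sequence with a positive limit when 0 < q < 1.\<close>

definition qpoch :: "real \<Rightarrow> nat \<Rightarrow> real" where
  "qpoch q n = (1 - q) ^ n * qfact q n"

definition qpoch_inf :: "real \<Rightarrow> real" where
  "qpoch_inf q = lim (qpoch q)"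

lemma qpoch_0 [simp]: "qpoch q 0 = 1"
  by (simp add: qpoch_def)

lemma qpoch_Suc: "qpoch q (Suc n) = qpoch q n * (1 - q ^ Suc n)"
proof -
  have "qpoch q (Suc n) = (1 - q) ^ n * qfact q n * ((1 - q) * qint q (Suc n))"
    by (simp add: qpoch_def qfact_Suc)
  then show ?thesis by (simp only: qint_geometric qpoch_def)
qed

context
  fixes q :: real
  assumes q: "0 < q" "q < 1"
begin

lemma qpoch_pos: "0 < qpoch q n"
  using q qfact_pos[of q n] by (simp add: qpoch_def)

lemma decseq_qpoch: "decseq (qpoch q)"
proof (rule decseq_SucI)
  fix n
  have "qpoch q n * (1 - q ^ Suc n) \<le> qpoch q n * 1"
    using q qpoch_pos[of n] by (intro mult_left_mono) auto
  then show "qpoch q (Suc n) \<le> qpoch q n" by (simp only: qpoch_Suc mult_1_right)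
qed

lemma qpoch_le_1: "qpoch q n \<le> 1"
  using decseqD[OF decseq_qpoch, of 0 n] by simp

lemma qpoch_tendsto: "qpoch q \<longlonglongrightarrow> qpoch_inf q"
  and qpoch_inf_le: "qpoch_inf q \<le> qpoch q n"
proof -
  obtain L where L: "qpoch q \<longlonglongrightarrow> L" "\<And>n. L \<le> qpoch q n"
    using decseq_convergent[OF decseq_qpoch, of 0] qpoch_pos less_imp_le by metis
  then have "L = qpoch_inf q" unfolding qpoch_inf_def by (metis limI)
  with L show "qpoch q \<longlonglongrightarrow> qpoch_inf q" "qpoch_inf q \<le> qpoch q n" by auto
qed

text \<open>A product of factors 1 - x_j is at least 1 minus the sum of the x_j. This is applied
  only to the tail after an index N at which the geometric tail sum is below 1/2, so that at least
  half of \<open>qpoch q N\<close> survives.\<close>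

lemma qpoch_inf_pos: "0 < qpoch_inf q"
proof -
  have "(\<lambda>n. q ^ Suc n / (1 - q)) \<longlonglongrightarrow> 0 / (1 - q)"
    using q by (intro tendsto_intros LIMSEQ_Suc LIMSEQ_power_zero) auto
  then have "eventually (\<lambda>n. q ^ Suc n / (1 - q) < 1 / 2) sequentially"
    by (rule order_tendstoD(2)) simp
  then obtain N where N: "q ^ Suc N / (1 - q) < 1 / 2"
    by (auto simp: eventually_sequentially)
  have *: "qpoch q N * (1 - q ^ Suc N * qint q m) \<le> qpoch q (N + m)" for m
  proof (induction m)
    case (Suc m)
    let ?S = "q ^ Suc N * qint q m" and ?x = "q ^ Suc (N + m)"
    have x: "0 \<le> ?x" "?x \<le> 1" using q power_le_one[of q "Suc (N + m)"] by (auto simp del: power_Suc)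
    have S: "0 \<le> ?S" using q by (intro mult_nonneg_nonneg qint_nonneg) auto
    have "qpoch q N * (1 - q ^ Suc N * qint q (Suc m)) = qpoch q N * (1 - ?S - ?x)"
      by (simp add: qint_Suc power_add algebra_simps)
    also have "\<dots> \<le> qpoch q N * ((1 - ?S) * (1 - ?x))"
      using qpoch_pos[of N] mult_nonneg_nonneg[OF S x(1)] by (intro mult_left_mono) (auto simp: algebra_simps)
    also have "\<dots> = qpoch q N * (1 - ?S) * (1 - ?x)" by simp
    also have "\<dots> \<le> qpoch q (N + m) * (1 - ?x)"
      using x by (intro mult_right_mono Suc) auto
    finally show ?case by (simp add: qpoch_Suc)
  qed simp
  have "qpoch q N / 2 \<le> qpoch q (N + m)" for m
  proof -
    have "(1 - q) * qint q m \<le> 1" using q by (simp add: qint_geometric)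
    then have "qint q m \<le> 1 / (1 - q)" using q by (simp add: field_simps)
    then have "q ^ Suc N * qint q m \<le> q ^ Suc N * (1 / (1 - q))"
      using q by (intro mult_left_mono) auto
    then have "1 / 2 \<le> 1 - q ^ Suc N * qint q m" using N by (simp only: mult_1_right times_divide_eq_right)
    then have "qpoch q N * (1 / 2) \<le> qpoch q N * (1 - q ^ Suc N * qint q m)"
      using qpoch_pos[of N] by (intro mult_left_mono) auto
    with *[of m] show ?thesis by simp
  qed
  then have "qpoch q N / 2 \<le> qpoch_inf q"
    using LIMSEQ_ignore_initial_segment[OF qpoch_tendsto, of N]
    by (intro LIMSEQ_le_const) (auto simp: add.commute)
  then show ?thesis using qpoch_pos[of N] by simp
qed

end

definition orbit_mean :: "real \<Rightarrow> (int set \<Rightarrow> real) \<Rightarrow> nat \<Rightarrow> nat \<Rightarrow> real" where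
  "orbit_mean q \<phi> a b = (\<Sum>p | p permutes {- int a..int b}. mallows_prob {- int a..int b} q p * \<phi> (orb p 0))"

text \<open>The exponent is the size of the block {-s..t}: it is the power of 1 - q left over when
  the q-factorials of the window and of the two outer parts are rewritten as
  \<open>qpoch\<close>.\<close>

definition block_mass :: "real \<Rightarrow> (int set \<Rightarrow> real) \<Rightarrow> nat \<times> nat \<Rightarrow> real" where
  "block_mass q \<phi> = (\<lambda>(s, t). (1 - q) ^ (s + t + 1) * block_sum q \<phi> s t)"

text \<open>The factor in front is the limit u * u / u of
  \<open>qpoch q (a - s) * qpoch q (b - t) / qpoch q (a + b + 1)\<close>, where u is
  \<open>qpoch_inf q\<close>. Enumerating the pairs (s, t) makes a single series out of the sum over
  blocks.\<close>

definition orbit_mean_limit :: "real \<Rightarrow> (int set \<Rightarrow> real) \<Rightarrow> real" where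
  "orbit_mean_limit q \<phi> = qpoch_inf q * (\<Sum>k. block_mass q \<phi> (prod_decode k))"

definition cycle_prob :: "real \<Rightarrow> nat \<Rightarrow> real" where
  "cycle_prob q i = orbit_mean_limit q (\<lambda>C. of_bool (card C = i))"

lemma mallows_prob_interval: "mallows_prob {a..b} q p = q ^ inv_count {a..b} p / qfact q (nat (b - a + 1))"
  by (simp add: mallows_prob_def sum_inv_count)

lemma sum_mallows_prob:
  assumes "0 < q"
  shows "(\<Sum>p | p permutes {a..b}. mallows_prob {a..b} q p) = 1"
  using qfact_pos[OF assms, of "nat (b - a + 1)"]
  by (simp add: mallows_prob_interval sum_inv_count flip: sum_divide_distrib)

lemma mallows_prob_pos: "0 < q \<Longrightarrow> 0 < mallows_prob {a..b} q p"
  using qfact_pos[of q "nat (b - a + 1)"] by (simp add: mallows_prob_interval)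

lemma finite_permutes_interval [simp]: "finite {p. p permutes {a..b::int}}"
  by (rule finite_permutations) simp

lemma orb_permutes:
  assumes "p permutes S" "x \<in> S"
  shows "orb p x \<subseteq> S" "x \<in> orb p x"
proof -
  have "(p ^^ k) x \<in> S" for k
    by (induction k) (use assms permutes_in_image[OF assms(1)] in auto)
  then show "orb p x \<subseteq> S" by (auto simp: orb_def)
  show "x \<in> orb p x" unfolding orb_def by (auto intro!: exI[of _ 0])
qed

context
  fixes q :: real
  assumes q: "0 < q" "q < 1"
begin

lemma orbit_mean_blocks:
  "orbit_mean q \<phi> a b = (\<Sum>(s, t)\<in>{..a} \<times> {..b}.
     qpoch q (a - s) * qpoch q (b - t) / qpoch q (a + b + 1) * block_mass q \<phi> (s, t))"
proof -
  have nz: "1 - q \<noteq> 0" using q by simp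
  have *: "nat (int b - - int a + 1) = a + b + 1" by simp
  have "orbit_mean q \<phi> a b = (\<Sum>p | p permutes {- int a..int b}. \<phi> (orb p 0) * q ^ inv_count {- int a..int b} p)
      / qfact q (a + b + 1)"
    unfolding orbit_mean_def mallows_prob_interval * sum_divide_distrib
    by (intro sum.cong) auto
  also have "\<dots> = (\<Sum>(s, t)\<in>{..a} \<times> {..b}. qfact q (a - s) * qfact q (b - t) * block_sum q \<phi> s t / qfact q (a + b + 1))"
    unfolding sum_permutes_blocks sum_divide_distrib by (intro sum.cong) auto
  also have "\<dots> = (\<Sum>(s, t)\<in>{..a} \<times> {..b}.
     qpoch q (a - s) * qpoch q (b - t) / qpoch q (a + b + 1) * block_mass q \<phi> (s, t))"
  proof (rule sum.cong[OF refl])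
    fix st assume "st \<in> {..a} \<times> {..b}"
    then obtain s t where eq: "st = (s, t)" and "s \<le> a" "t \<le> b" by auto
    then have "a + b + 1 = (a - s) + (b - t) + (s + t + 1)" by simp
    then have "(1 - q) ^ (a + b + 1) = (1 - q) ^ (a - s) * (1 - q) ^ (b - t) * (1 - q) ^ (s + t + 1)"
      by (metis power_add)
    moreover have "(1 - q) ^ (a + b + 1) \<noteq> 0" using nz by simp
    ultimately show "(case st of (s, t) \<Rightarrow> qfact q (a - s) * qfact q (b - t) * block_sum q \<phi> s t / qfact q (a + b + 1))
      = (case st of (s, t) \<Rightarrow> qpoch q (a - s) * qpoch q (b - t) / qpoch q (a + b + 1) * block_mass q \<phi> (s, t))"
      unfolding eq qpoch_def block_mass_def prod.case by (simp only: divide_simps) simp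
  qed
  finally show ?thesis .
qed

lemma block_mass_bounds:
  assumes "\<And>C. 0 \<le> \<phi> C" "\<And>C. \<phi> C \<le> 1"
  shows "0 \<le> block_mass q \<phi> st" "block_mass q \<phi> st \<le> block_mass q (\<lambda>_. 1) st"
proof -
  obtain s t where st: "st = (s, t)" by force
  show "0 \<le> block_mass q \<phi> st"
    using q assms unfolding st block_mass_def block_sum_def by (auto intro!: mult_nonneg_nonneg sum_nonneg)
  show "block_mass q \<phi> st \<le> block_mass q (\<lambda>_. 1) st"
    using q assms unfolding st block_mass_def block_sum_def prod.case
    by (intro mult_left_mono sum_mono mult_right_mono) auto
qed

lemma orbit_mean_1: "orbit_mean q (\<lambda>_. 1) a b = 1"
  using q sum_mallows_prob[of q "- int a" "int b"] by (simp add: orbit_mean_def)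

text \<open>In every finite window the total probability 1 is a sum of block masses with
  coefficients at least u^2, where u is \<open>qpoch_inf q\<close>: both numerators are at least u
  and the denominator is at most 1. Hence all partial sums are at most 1/u^2.\<close>

lemma summable_block_mass: "summable (\<lambda>k. block_mass q (\<lambda>_. 1) (prod_decode k))"
proof (rule summableI_nonneg_bounded)
  let ?w = "block_mass q (\<lambda>_. 1)" and ?u = "qpoch_inf q"
  have u: "0 < ?u" "\<And>n. ?u \<le> qpoch q n" "\<And>n. 0 < qpoch q n" "\<And>n. qpoch q n \<le> 1"
    using qpoch_inf_pos[OF q] qpoch_inf_le[OF q] qpoch_pos[OF q] qpoch_le_1[OF q] by auto
  have w: "0 \<le> ?w st" for st by (rule block_mass_bounds) auto
  then show "0 \<le> ?w (prod_decode n)" for n .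
  fix n
  define X where "X = prod_decode ` {..<n}"
  have "finite X" by (simp add: X_def)
  then obtain a where a: "fst ` X \<subseteq> {..a}" "snd ` X \<subseteq> {..a}"
    by (metis finite_Un finite_imageI finite_nat_iff_bounded_le le_sup_iff)
  have "?u\<^sup>2 * (\<Sum>k<n. ?w (prod_decode k)) = (\<Sum>st\<in>X. ?u\<^sup>2 * ?w st)"
    unfolding X_def sum_distrib_left by (subst sum.reindex) (auto simp: inj_prod_decode)
  also have "\<dots> \<le> (\<Sum>st\<in>{..a} \<times> {..a}. ?u\<^sup>2 * ?w st)"
    using a w by (intro sum_mono2) force+
  also have "\<dots> \<le> (\<Sum>(s, t)\<in>{..a} \<times> {..a}.
      qpoch q (a - s) * qpoch q (a - t) / qpoch q (a + a + 1) * ?w (s, t))"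
  proof (rule sum_mono, clarify)
    fix s t
    have "?u\<^sup>2 \<le> qpoch q (a - s) * qpoch q (a - t)"
      unfolding power2_eq_square using u by (intro mult_mono) (auto intro: less_imp_le)
    also have "\<dots> \<le> qpoch q (a - s) * qpoch q (a - t) / qpoch q (a + a + 1)"
      using u(3)[of "a - s"] u(3)[of "a - t"] u(3,4)[of "a + a + 1"]
      by (simp add: le_divide_eq mult_left_le)
    finally show "?u\<^sup>2 * ?w (s, t) \<le> qpoch q (a - s) * qpoch q (a - t) / qpoch q (a + a + 1) * ?w (s, t)"
      by (rule mult_right_mono) (rule w)
  qed
  also have "\<dots> = 1" by (simp only: orbit_mean_blocks[symmetric] orbit_mean_1)
  finally show "(\<Sum>k<n. ?w (prod_decode k)) \<le> 1 / ?u\<^sup>2"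
    using u(1) by (simp add: field_simps)
qed

text \<open>Dominated convergence over the blocks: the coefficients converge to u and never exceed
  1/u, with u = \<open>qpoch_inf q\<close>, and the masses of the constant 1 are summable. The
  product filter lets a and b grow at unrelated speeds.\<close>

lemma orbit_mean_tendsto:
  assumes \<phi>: "\<And>C. 0 \<le> \<phi> C" "\<And>C. \<phi> C \<le> 1"
  shows "((\<lambda>(a, b). orbit_mean q \<phi> a b) \<longlongrightarrow> orbit_mean_limit q \<phi>) (at_top \<times>\<^sub>F at_top)"
proof -
  let ?u = "qpoch_inf q"
  have u: "0 < ?u" "\<And>n. ?u \<le> qpoch q n" "\<And>n. 0 < qpoch q n" "\<And>n. qpoch q n \<le> 1"
    using qpoch_inf_pos[OF q] qpoch_inf_le[OF q] qpoch_pos[OF q] qpoch_le_1[OF q] by auto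
  \<comment> \<open>Extension by 0 to blocks that do not fit into the window gives, for every
    window, a series over the same index set.\<close>
  define c where "c = (\<lambda>(s, t) (a, b). if s \<le> a \<and> t \<le> b
    then qpoch q (a - s) * qpoch q (b - t) / qpoch q (a + b + 1) * block_mass q \<phi> (s, t) else 0)"
  have lim: "(c st \<longlongrightarrow> ?u * block_mass q \<phi> st) (at_top \<times>\<^sub>F at_top)" for st
  proof -
    obtain s t where st: "st = (s, t)" by force
    have fst: "filterlim (\<lambda>x. fst x - m) at_top (at_top \<times>\<^sub>F (at_top :: nat filter))" for m :: nat
      by (rule filterlim_compose[OF filterlim_minus_const_nat_at_top filterlim_fst])
    have snd: "filterlim (\<lambda>x. snd x - m) at_top ((at_top :: nat filter) \<times>\<^sub>F at_top)" for m :: nat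
      by (rule filterlim_compose[OF filterlim_minus_const_nat_at_top filterlim_snd])
    have sm: "filterlim (\<lambda>x. fst x + snd x + 1) at_top ((at_top :: nat filter) \<times>\<^sub>F at_top)"
      by (rule filterlim_at_top_mono[OF filterlim_fst]) auto
    have "((\<lambda>x. qpoch q (fst x - s) * qpoch q (snd x - t) / qpoch q (fst x + snd x + 1) * block_mass q \<phi> (s, t))
        \<longlongrightarrow> ?u * ?u / ?u * block_mass q \<phi> (s, t)) (at_top \<times>\<^sub>F at_top)"
      using u(1) by (intro tendsto_intros filterlim_compose[OF qpoch_tendsto[OF q]] fst snd sm) auto
    moreover have "eventually (\<lambda>x. qpoch q (fst x - s) * qpoch q (snd x - t) / qpoch q (fst x + snd x + 1) * block_mass q \<phi> (s, t)
        = c st x) (at_top \<times>\<^sub>F at_top)"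
      using eventually_prodI[OF eventually_ge_at_top[of s] eventually_ge_at_top[of t]]
      by eventually_elim (auto simp: c_def st)
    ultimately show ?thesis
      using u(1) unfolding st by (auto intro: Lim_transform_eventually)
  qed
  have bound: "norm (c st x) \<le> 1 / ?u * block_mass q (\<lambda>_. 1) st" for st x
  proof -
    obtain s t a b where st: "st = (s, t)" "x = (a, b)" by (cases st, cases x) auto
    have "qpoch q (a - s) * qpoch q (b - t) / qpoch q (a + b + 1) \<le> 1 * 1 / ?u"
      using u less_imp_le[OF u(3)] by (intro frac_le mult_mono) auto
    then have "qpoch q (a - s) * qpoch q (b - t) / qpoch q (a + b + 1) * block_mass q \<phi> (s, t)
        \<le> 1 / ?u * block_mass q (\<lambda>_. 1) (s, t)"
      using block_mass_bounds[of \<phi> "(s, t)"] \<phi> u(1) by (intro mult_mono) auto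
    moreover have "0 \<le> qpoch q (a - s) * qpoch q (b - t) / qpoch q (a + b + 1) * block_mass q \<phi> (s, t)"
      using block_mass_bounds[of \<phi> "(s, t)"] \<phi> less_imp_le[OF u(3)] by auto
    moreover have "0 \<le> 1 / ?u * block_mass q (\<lambda>_. 1) (s, t)"
      using block_mass_bounds[of "\<lambda>_. 1" "(s, t)"] u(1) by auto
    ultimately show ?thesis unfolding st c_def by auto
  qed
  have "((\<lambda>x. \<Sum>k. c (prod_decode k) x) \<longlongrightarrow> (\<Sum>k. ?u * block_mass q \<phi> (prod_decode k))) (at_top \<times>\<^sub>F at_top)"
    by (rule suminf_tendsto_dominated[OF lim bound])
      (use summable_mult[OF summable_block_mass] in \<open>auto simp: prod_filter_eq_bot\<close>)
  moreover have "(\<Sum>k. c (prod_decode k) (a, b)) = orbit_mean q \<phi> a b" for a b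
  proof -
    have "(\<Sum>k. c (prod_decode k) (a, b)) = (\<Sum>k\<in>prod_encode ` ({..a} \<times> {..b}). c (prod_decode k) (a, b))"
      by (rule suminf_finite) (auto simp: c_def image_iff split: prod.splits,
          metis atMost_iff mem_Sigma_iff prod_decode_inverse)
    also have "\<dots> = (\<Sum>st\<in>{..a} \<times> {..b}. c st (a, b))"
      by (subst sum.reindex) (auto simp: inj_prod_encode)
    also have "\<dots> = orbit_mean q \<phi> a b"
      unfolding orbit_mean_blocks by (intro sum.cong) (auto simp: c_def)
    finally show ?thesis .
  qed
  moreover have "summable (\<lambda>k. block_mass q \<phi> (prod_decode k))"
    by (rule summable_comparison_test'[OF summable_block_mass, of 0])
      (use block_mass_bounds[of \<phi>] \<phi> in auto)
  moreover have "(\<lambda>x. \<Sum>k. c (prod_decode k) x) = (\<lambda>(a, b). orbit_mean q \<phi> a b)"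
    using calculation(2) by auto
  ultimately show ?thesis
    by (simp add: orbit_mean_limit_def suminf_mult)
qed

lemma orbit_mean_limit_1: "orbit_mean_limit q (\<lambda>_. 1) = 1"
proof -
  have "((\<lambda>(a, b). orbit_mean q (\<lambda>_. 1) a b) \<longlongrightarrow> 1) (at_top \<times>\<^sub>F at_top)"
    by (simp add: orbit_mean_1 case_prod_unfold)
  from tendsto_unique[OF _ orbit_mean_tendsto this] show ?thesis
    by (auto simp: prod_filter_eq_bot)
qed

text \<open>Inside the block {-s..t} the orbit of 0 has between 1 and s + t + 1 points. The mass of
  the block with cycle length at most N therefore equals its full mass as soon as N >= s + t + 1,
  and dominated convergence in N gives the total mass 1.\<close>

lemma cycle_prob_sums: "(\<lambda>i. cycle_prob q (Suc i)) sums 1"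
  unfolding sums_def
proof -
  let ?\<phi> = "\<lambda>N C. of_bool (card C \<in> Suc ` {..<N}) :: real"
  have eq: "(\<Sum>i<N. cycle_prob q (Suc i)) = orbit_mean_limit q (?\<phi> N)" for N
  proof -
    have "((\<lambda>x. \<Sum>i<N. case x of (a, b) \<Rightarrow> orbit_mean q (\<lambda>C. of_bool (card C = Suc i)) a b)
        \<longlongrightarrow> (\<Sum>i<N. cycle_prob q (Suc i))) (at_top \<times>\<^sub>F at_top)"
      unfolding cycle_prob_def by (intro tendsto_sum orbit_mean_tendsto) auto
    moreover have "(\<Sum>i<N. orbit_mean q (\<lambda>C. of_bool (card C = Suc i)) a b) = orbit_mean q (?\<phi> N) a b" for a b
    proof -
      have "(\<Sum>i<N. of_bool (card C = Suc i)) = ?\<phi> N C" for C :: "int set"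
        by (cases "card C") (auto simp: of_bool_def sum.delta')
      then show ?thesis
        unfolding orbit_mean_def by (subst sum.swap) (simp flip: sum_distrib_left)
    qed
    ultimately have "((\<lambda>(a, b). orbit_mean q (?\<phi> N) a b) \<longlongrightarrow> (\<Sum>i<N. cycle_prob q (Suc i))) (at_top \<times>\<^sub>F at_top)"
      by (simp add: case_prod_unfold)
    then show ?thesis
      by (rule tendsto_unique[rotated, OF _ orbit_mean_tendsto]) (auto simp: prod_filter_eq_bot)
  qed
  have "(\<lambda>N. \<Sum>k. block_mass q (?\<phi> N) (prod_decode k)) \<longlonglongrightarrow> (\<Sum>k. block_mass q (\<lambda>_. 1) (prod_decode k))"
  proof (rule suminf_tendsto_dominated[OF _ _ summable_block_mass])
    fix k
    obtain s t where st: "prod_decode k = (s, t)" by force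
    have "block_mass q (?\<phi> N) (s, t) = block_mass q (\<lambda>_. 1) (s, t)" if "s + t + 1 \<le> N" for N
    proof -
      have "?\<phi> N (orb p 0) = 1" if "p \<in> irreducible_perms s t" for p
      proof -
        have p: "p permutes {- int s..int t}" using that by (simp add: irreducible_perms_def)
        have sub: "orb p 0 \<subseteq> {- int s..int t}" "0 \<in> orb p 0" using orb_permutes[OF p, of 0] by auto
        then have "finite (orb p 0)" by (auto intro: finite_subset)
        then have "0 < card (orb p 0)" using sub by (auto simp: card_gt_0_iff)
        moreover have "card (orb p 0) \<le> card {- int s..int t}" using sub by (intro card_mono) auto
        ultimately show ?thesis using \<open>s + t + 1 \<le> N\<close> by (cases "card (orb p 0)") auto
      qed
      then show ?thesis
        unfolding block_mass_def block_sum_def prod.case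
        by (intro arg_cong[where f = "(*) _"] sum.cong refl) simp
    qed
    then show "(\<lambda>N. block_mass q (?\<phi> N) (prod_decode k)) \<longlonglongrightarrow> block_mass q (\<lambda>_. 1) (prod_decode k)"
      unfolding st by (intro tendsto_eventually) (auto simp: eventually_sequentially)
  next
    show "norm (block_mass q (?\<phi> N) (prod_decode k)) \<le> block_mass q (\<lambda>_. 1) (prod_decode k)" for k N
      using block_mass_bounds[of "?\<phi> N"] by auto
  qed simp
  then have "(\<lambda>N. orbit_mean_limit q (?\<phi> N)) \<longlonglongrightarrow> orbit_mean_limit q (\<lambda>_. 1)"
    unfolding orbit_mean_limit_def by (intro tendsto_mult_left)
  then show "(\<lambda>N. \<Sum>i<N. cycle_prob q (Suc i)) \<longlonglongrightarrow> 1"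
    unfolding eq orbit_mean_limit_1 .
qed

end

section \<open>Cycle counts\<close>

lemma orb_eq_orbit: "permutation p \<Longrightarrow> orb p x = orbit p x"
  by (simp add: orb_def orbit_altdef_permutation)

lemma orb_eq: "permutation p \<Longrightarrow> y \<in> orb p x \<Longrightarrow> orb p y = orb p x"
  by (simp add: orb_eq_orbit orbit_cyclic_eq3[OF cyclic_on_orbit'])

lemma self_in_orb: "x \<in> orb p x"
  unfolding orb_def by (auto intro!: exI[of _ 0])

lemma card_eq_sum_of_bool: "finite A \<Longrightarrow> real (card {x \<in> A. P x}) = (\<Sum>x\<in>A. of_bool (P x))"
  by (simp add: Collect_conj_eq)

lemma cycle_count_mult:
  assumes p: "p permutes A" "finite A"
  shows "i * cycle_count i A p = card {x \<in> A. card (orb p x) = i}"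
proof -
  have perm: "permutation p" using p by (auto simp: permutation_permutes)
  let ?C = "{C. \<exists>x\<in>A. C = orb p x \<and> card C = i}"
  have U: "\<Union>?C = {x \<in> A. card (orb p x) = i}"
  proof (intro equalityI subsetI)
    fix y assume "y \<in> \<Union>?C"
    then obtain x where x: "x \<in> A" "y \<in> orb p x" "card (orb p x) = i" by auto
    then show "y \<in> {x \<in> A. card (orb p x) = i}"
      using orb_permutes(1)[OF p(1) x(1)] orb_eq[OF perm x(2)] by auto
  qed (use self_in_orb in auto)
  have "finite ?C" using p(2) by (auto intro: finite_subset[of _ "orb p ` A"])
  moreover have "finite (\<Union>?C)" unfolding U using p by auto
  moreover have "C1 \<inter> C2 = {}" if C: "C1 \<in> ?C" "C2 \<in> ?C" "C1 \<noteq> C2" for C1 C2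
  proof (rule ccontr)
    assume "C1 \<inter> C2 \<noteq> {}"
    then obtain y where "y \<in> C1" "y \<in> C2" by blast
    moreover obtain x1 x2 where "C1 = orb p x1" "C2 = orb p x2" using C by blast
    ultimately show False using orb_eq[OF perm] C(3) by metis
  qed
  ultimately show ?thesis
    unfolding cycle_count_def U[symmetric] by (intro card_partition) auto
qed

text \<open>A cycle is recovered from any of its points. The maximum is the useful representative
  because being the maximum of its cycle forces the value at x once the values below x are known.
  For i > 0 the cycle is finite and nonempty, so \<open>Max\<close> is meaningful.\<close>

lemma cycle_count_le:
  assumes p: "p permutes A" "finite A" and i: "0 < i"
  shows "cycle_count i A p \<le> card {x \<in> A. x = Max (orb p x) \<and> card (orb p x) = i}"
proof -
  have perm: "permutation p" using p by (auto simp: permutation_permutes)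
  let ?C = "{C. \<exists>x\<in>A. C = orb p x \<and> card C = i}"
  have max: "Max C \<in> A \<and> C = orb p (Max C)" if C: "C \<in> ?C" for C
  proof -
    obtain x where x: "x \<in> A" "C = orb p x" "card C = i" using C by blast
    then have "Max C \<in> C" using i by (intro Max_in) (auto intro: card_ge_0_finite)
    then show ?thesis using orb_eq[OF perm] orb_permutes(1)[OF p(1) x(1)] x(2) by auto
  qed
  show ?thesis
    unfolding cycle_count_def
  proof (rule card_inj_on_le)
    show "inj_on Max ?C" using max by (intro inj_on_inverseI[where g = "orb p"]) simp
    show "Max ` ?C \<subseteq> {x \<in> A. x = Max (orb p x) \<and> card (orb p x) = i}"
    proof (rule image_subsetI)
      fix C assume C: "C \<in> ?C"
      then have "card C = i" by blast
      moreover have "orb p (Max C) = C" "Max C \<in> A" using max[OF C] by simp_all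
      ultimately show "Max C \<in> {x \<in> A. x = Max (orb p x) \<and> card (orb p x) = i}" by simp
    qed
  qed (use p in auto)
qed

lemma sum_cycle_count_le:
  assumes p: "p permutes A" "finite A"
  shows "(\<Sum>i<k. cycle_count (Suc i) A p) \<le> card {x \<in> A. x = Max (orb p x)}"
proof -
  have "(\<Sum>i<k. cycle_count (Suc i) A p) \<le> (\<Sum>i<k. card {x \<in> A. x = Max (orb p x) \<and> card (orb p x) = Suc i})"
    by (intro sum_mono cycle_count_le p) simp
  also have "\<dots> = card (\<Union>i<k. {x \<in> A. x = Max (orb p x) \<and> card (orb p x) = Suc i})"
    using p by (intro card_UN_disjoint[symmetric]) auto
  also have "\<dots> \<le> card {x \<in> A. x = Max (orb p x)}"
    using p by (intro card_mono) auto
  finally show ?thesis .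
qed

section \<open>Translation invariance and averaging over positions\<close>

lemma shift_permutes:
  fixes p :: "int \<Rightarrow> int"
  assumes "p permutes {a..b}"
  shows "(\<lambda>z. p (z + x) - x) permutes {a - x..b - x}"
proof -
  have "bij_betw (\<lambda>z. p (z + x) - x) {a - x..b - x} {a - x..b - x}"
  proof (intro bij_betw_byWitness[where f' = "\<lambda>z. inv p (z + x) - x"])
    have 1: "p z \<in> {a..b}" "inv p z \<in> {a..b}" if "z \<in> {a..b}" for z
      using that permutes_in_image[OF assms] permutes_in_image[OF permutes_inv[OF assms]] by auto
    show "(\<lambda>z. p (z + x) - x) ` {a - x..b - x} \<subseteq> {a - x..b - x}"
      using 1(1)[of "_ + x"] by force
    show "(\<lambda>z. inv p (z + x) - x) ` {a - x..b - x} \<subseteq> {a - x..b - x}"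
      using 1(2)[of "_ + x"] by force
  qed (simp_all add: permutes_inverses[OF assms])
  then show ?thesis
    by (rule bij_imp_permutes) (use permutes_not_in[OF assms] in auto)
qed

lemma inv_count_shift: "inv_count {a - x..b - x} (\<lambda>z. p (z + x) - x) = inv_count {a..b} p"
  unfolding inv_count_def
  by (rule bij_betw_same_card[of "\<lambda>(i, j). (i + x, j + x)"],
      rule bij_betw_byWitness[where f' = "\<lambda>(i, j). (i - x, j - x)"]) auto

lemma orb_shift: "orb p (z + x) = (\<lambda>y. y + x) ` orb (\<lambda>z. p (z + x) - x) z"
proof -
  have "((\<lambda>z. p (z + x) - x) ^^ k) z + x = (p ^^ k) (z + x)" for k
    by (induction k) auto
  then show ?thesis unfolding orb_def by (auto simp: image_iff) metis+
qed

lemma card_orb_shift: "card (orb (\<lambda>z. p (z + x) - x) z) = card (orb p (z + x))"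
  unfolding orb_shift by (simp add: card_image)

text \<open>The statistic is a function of the cardinality of the orbit because the orbit itself
  moves with the translation.\<close>

lemma sum_mallows_shift:
  fixes \<phi> :: "nat \<Rightarrow> real"
  shows "(\<Sum>p | p permutes {a..b}. mallows_prob {a..b} q p * \<phi> (card (orb p x)))
    = (\<Sum>p | p permutes {a - x..b - x}. mallows_prob {a - x..b - x} q p * \<phi> (card (orb p 0)))"
proof (rule sum.reindex_bij_witness[where j = "\<lambda>p z. p (z + x) - x" and i = "\<lambda>p z. p (z - x) + x"])
  fix p assume p: "p \<in> {p. p permutes {a..b}}"
  then show "(\<lambda>z. p (z + x) - x) \<in> {p. p permutes {a - x..b - x}}"
    using shift_permutes by blast
  show "mallows_prob {a - x..b - x} q (\<lambda>z. p (z + x) - x) * \<phi> (card (orb (\<lambda>z. p (z + x) - x) 0)) =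
       mallows_prob {a..b} q p * \<phi> (card (orb p x))"
    using card_orb_shift[of p x 0] by (simp add: mallows_prob_interval inv_count_shift)
next
  fix p assume "p \<in> {p. p permutes {a - x..b - x}}"
  then show "(\<lambda>z. p (z - x) + x) \<in> {p. p permutes {a..b}}"
    using shift_permutes[of p "a - x" "b - x" "- x"] by simp
qed auto

lemma exp_cycles_eq_sum:
  assumes "0 < i"
  shows "exp_cycles q i n = (\<Sum>x<n. orbit_mean q (\<lambda>C. of_bool (card C = i)) x (n - 1 - x)) / real i"
proof -
  let ?A = "{1..int n}"
  have "real (cycle_count i ?A p) = (\<Sum>x\<in>?A. of_bool (card (orb p x) = i)) / real i" if "p permutes ?A" for p
  proof -
    have "real i * real (cycle_count i ?A p) = (\<Sum>x\<in>?A. of_bool (card (orb p x) = i))"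
      using arg_cong[OF cycle_count_mult[OF that, of i], of real]
      by (simp only: card_eq_sum_of_bool finite_atLeastAtMost_int of_nat_mult simp_thms)
    then show ?thesis using assms by (simp add: field_simps)
  qed
  then have "exp_cycles q i n
      = (\<Sum>p | p permutes ?A. mallows_prob ?A q p * ((\<Sum>x\<in>?A. of_bool (card (orb p x) = i)) / real i))"
    unfolding exp_cycles_def by (intro sum.cong) auto
  also have "\<dots> = (\<Sum>p | p permutes ?A. \<Sum>x\<in>?A. mallows_prob ?A q p * of_bool (card (orb p x) = i)) / real i"
    by (simp only: sum_distrib_left sum_divide_distrib times_divide_eq_right)
  also have "(\<Sum>p | p permutes ?A. \<Sum>x\<in>?A. mallows_prob ?A q p * of_bool (card (orb p x) = i))
      = (\<Sum>x\<in>?A. \<Sum>p | p permutes ?A. mallows_prob ?A q p * of_bool (card (orb p x) = i))"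
    by (rule sum.swap)
  also have "\<dots> = (\<Sum>x<n. orbit_mean q (\<lambda>C. of_bool (card C = i)) x (n - 1 - x))"
  proof (rule sum.reindex_bij_witness[where j = "\<lambda>x. nat (x - 1)" and i = "\<lambda>x. int x + 1"])
    \<comment> \<open>After moving x to the origin, x - 1 points of {1..n} lie to its left and n - x
      to its right.\<close>
    fix x :: int assume x: "x \<in> ?A"
    then have "{1 - x..int n - x} = {- int (nat (x - 1))..int (n - 1 - nat (x - 1))}" by auto
    then show "orbit_mean q (\<lambda>C. of_bool (card C = i)) (nat (x - 1)) (n - 1 - nat (x - 1))
      = (\<Sum>p | p permutes ?A. mallows_prob ?A q p * of_bool (card (orb p x) = i))"
      unfolding orbit_mean_def sum_mallows_shift[of 1 "int n" q "\<lambda>k. of_bool (k = i)" x] by (simp only:)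
  qed auto
  finally show ?thesis .
qed

text \<open>Away from the first K and the last K positions both arguments are large and F is close
  to L. The at most 2K remaining terms deviate by at most B each and disappear after division by
  n.\<close>

lemma cesaro_two_sided:
  fixes F :: "nat \<Rightarrow> nat \<Rightarrow> real"
  assumes lim: "((\<lambda>(a, b). F a b) \<longlongrightarrow> L) (at_top \<times>\<^sub>F at_top)"
    and bound: "\<And>a b. \<bar>F a b - L\<bar> \<le> B"
  shows "(\<lambda>n. (\<Sum>x<n. F x (n - 1 - x)) / real n) \<longlonglongrightarrow> L"
proof (rule LIMSEQ_I)
  fix r :: real assume r: "0 < r"
  have "eventually (\<lambda>(a, b). \<bar>F a b - L\<bar> < r / 2) (at_top \<times>\<^sub>F at_top)"
    using tendstoD[OF lim, of "r / 2"] r by (simp add: dist_real_def case_prod_unfold)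
  then obtain K where K: "\<And>a b. a \<ge> K \<Longrightarrow> b \<ge> K \<Longrightarrow> \<bar>F a b - L\<bar> < r / 2"
    unfolding eventually_prod_sequentially by auto
  have B: "0 \<le> B" using bound[of 0 0] by linarith
  \<comment> \<open>Chosen so that the boundary contribution 2KB is less than nr/2 for n > N, the
    other half of the error budget.\<close>
  obtain N where N: "real N > 4 * real K * B / r" using reals_Archimedean2 by blast
  show "\<exists>N. \<forall>n\<ge>N. norm ((\<Sum>x<n. F x (n - 1 - x)) / real n - L) < r"
  proof (intro exI allI impI)
    fix n assume n: "Suc N \<le> n"
    have "\<bar>\<Sum>x<n. F x (n - 1 - x) - L\<bar> \<le> (\<Sum>x<n. \<bar>F x (n - 1 - x) - L\<bar>)"
      by (rule sum_abs)
    also have "\<dots> \<le> (\<Sum>x<n. r / 2 + (B * of_bool (x < K) + B * of_bool (n - 1 - x < K)))"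
    proof (rule sum_mono)
      fix x
      show "\<bar>F x (n - 1 - x) - L\<bar> \<le> r / 2 + (B * of_bool (x < K) + B * of_bool (n - 1 - x < K))"
        using K[of x "n - 1 - x"] bound[of x "n - 1 - x"] r B by (cases "x < K"; cases "n - 1 - x < K") auto
    qed
    also have "\<dots> = real n * (r / 2) + (B * (\<Sum>x<n. of_bool (x < K)) + B * (\<Sum>x<n. of_bool (n - 1 - x < K)))"
      by (simp only: sum.distrib sum_distrib_left[symmetric]) simp
    also have "(\<Sum>x<n. of_bool (n - 1 - x < K)) = (\<Sum>x<n. of_bool (x < K) :: real)"
      by (rule sum.reindex_bij_witness[where i = "\<lambda>x. n - 1 - x" and j = "\<lambda>x. n - 1 - x"]) auto
    also have "(\<Sum>x<n. of_bool (x < K) :: real) = real (card ({..<n} \<inter> {x. x < K}))" by simp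
    also have "real n * (r / 2) + (B * real (card ({..<n} \<inter> {x. x < K})) + B * real (card ({..<n} \<inter> {x. x < K})))
        \<le> real n * (r / 2) + (B * real K + B * real K)"
    proof -
      have "card ({..<n} \<inter> {x. x < K}) \<le> card {..<K}" by (intro card_mono) auto
      then have "B * real (card ({..<n} \<inter> {x. x < K})) \<le> B * real K" using B by (intro mult_left_mono) auto
      then show ?thesis by simp
    qed
    finally have 1: "\<bar>\<Sum>x<n. F x (n - 1 - x) - L\<bar> \<le> real n * (r / 2) + 2 * (real K * B)"
      by (simp only: mult_2 mult.commute[of B])
    have "4 * real K * B / r < real n" using N n by linarith
    then have "2 * (real K * B) < real n * (r / 2)" using r by (simp add: field_simps)
    with 1 have "\<bar>\<Sum>x<n. F x (n - 1 - x) - L\<bar> < real n * r" by (simp add: field_simps)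
    moreover have "(\<Sum>x<n. F x (n - 1 - x)) / real n - L = (\<Sum>x<n. F x (n - 1 - x) - L) / real n"
      using n by (simp add: sum_subtractf diff_divide_distrib)
    ultimately show "norm ((\<Sum>x<n. F x (n - 1 - x)) / real n - L) < r"
      using n by (simp add: divide_less_eq mult.commute)
  qed
qed

text \<open>If \<open>x\<close> is the maximum of its cycle under both permutations, then following the cycle backwards
  from \<open>x\<close> only visits points below \<open>x\<close>, where the permutations agree; this pins down the image of \<open>x\<close>.\<close>

lemma image_of_cycle_max_determined:
  fixes p p' :: "int \<Rightarrow> int"
  assumes p: "permutation p" "permutation p'"
    and agree: "\<And>y. y \<in> orb p' x \<Longrightarrow> y < x \<Longrightarrow> p y = p' y"
    and max: "x = Max (orb p x)" "x = Max (orb p' x)"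
    and least: "0 < m" "(p ^^ m) x = x" "\<And>j. 0 < j \<Longrightarrow> j < m \<Longrightarrow> (p ^^ j) x \<noteq> x"
    and least': "(p' ^^ m') x = x" "\<And>j. 0 < j \<Longrightarrow> j < m' \<Longrightarrow> (p' ^^ j) x \<noteq> x"
    and le: "m \<le> m'"
  shows "p x = p' x"
proof -
  have fin: "finite (orb p x)" "finite (orb p' x)"
    using p by (simp_all add: orb_eq_orbit finite_orbit permutation_self_in_orbit)
  have in_orb: "(p ^^ j) x \<in> orb p x" "(p' ^^ j) x \<in> orb p' x" for j by (auto simp: orb_def)
  have less: "(p ^^ j) x < x" if "0 < j" "j < m" for j
    using Max_ge[OF fin(1) in_orb(1)[of j]] max(1) least(3)[OF that] by simp
  have less': "(p' ^^ j) x < x" if "0 < j" "j < m'" for j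
    using Max_ge[OF fin(2) in_orb(2)[of j]] max(2) least'(2)[OF that] by simp
  have inj: "inj p" using p(1) by (simp add: bij_is_inj permutation_bijective)
  have backwards: "j < m \<Longrightarrow> (p ^^ (m - j)) x = (p' ^^ (m' - j)) x" for j
  proof (induction j)
    case (Suc j)
    have s: "m - j = Suc (m - Suc j)" "m' - j = Suc (m' - Suc j)" using Suc le by auto
    have "p ((p ^^ (m - Suc j)) x) = p' ((p' ^^ (m' - Suc j)) x)"
      using Suc unfolding s by simp
    also have "\<dots> = p ((p' ^^ (m' - Suc j)) x)"
      using agree[OF in_orb(2)[of "m' - Suc j"]] less'[of "m' - Suc j"] Suc le by simp
    finally show ?case using inj by (simp add: inj_eq)
  qed (use least least' in simp)
  have "p x = (p' ^^ Suc (m' - m)) x"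
    using backwards[of "m - 1"] least(1) le by (simp add: Suc_diff_le)
  show ?thesis
  proof (cases "m = m'")
    case False
    \<comment> \<open>If the cycle under \<open>p'\<close> were longer, following both cycles back
      would end at a point y < x with p y = p x, contradicting injectivity of
      \<open>p\<close>.\<close>
    let ?y = "(p' ^^ (m' - m)) x"
    have y: "?y < x" using False le least(1) by (intro less') auto
    have "p x = p' ?y" using \<open>p x = _\<close> by simp
    also have "\<dots> = p ?y" using agree[OF in_orb(2)[of "m' - m"]] y by simp
    finally show ?thesis using inj y by (simp add: inj_eq)
  qed (use \<open>p x = _\<close> in simp)
qed

lemma image_of_cycle_max_eq:
  fixes p p' :: "int \<Rightarrow> int"
  assumes p: "p permutes {1..int n}" "p' permutes {1..int n}" and x: "x \<in> {1..int n}"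
    and agree: "\<And>y. 1 \<le> y \<Longrightarrow> y < x \<Longrightarrow> p y = p' y"
    and max: "x = Max (orb p x)" "x = Max (orb p' x)"
  shows "p x = p' x"
proof -
  have perm: "permutation p" "permutation p'" using p by (auto simp: permutation_permutes)
  have ex: "\<exists>m>0. (g ^^ m) x = x \<and> (\<forall>j. 0 < j \<longrightarrow> j < m \<longrightarrow> (g ^^ j) x \<noteq> x)"
    if g: "permutation g" for g
  proof -
    define m where "m = (LEAST m. 0 < m \<and> (g ^^ m) x = x)"
    obtain n where "0 < n \<and> (g ^^ n) x = x" using permutation_self[OF g, of x] by auto
    then have "0 < m \<and> (g ^^ m) x = x" unfolding m_def by (rule LeastI)
    moreover have "(g ^^ j) x \<noteq> x" if "0 < j" "j < m" for j
      using not_less_Least[OF that(2)[unfolded m_def]] that(1) by simp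
    ultimately show ?thesis by blast
  qed
  obtain m where m: "0 < m" "(p ^^ m) x = x" "\<And>j. 0 < j \<Longrightarrow> j < m \<Longrightarrow> (p ^^ j) x \<noteq> x"
    using ex[OF perm(1)] by auto
  obtain m' where m': "0 < m'" "(p' ^^ m') x = x" "\<And>j. 0 < j \<Longrightarrow> j < m' \<Longrightarrow> (p' ^^ j) x \<noteq> x"
    using ex[OF perm(2)] by auto
  have "p y = p' y" if "y < x" "y \<in> orb p x \<or> y \<in> orb p' x" for y
    using that agree[of y] orb_permutes(1)[OF p(1) x] orb_permutes(1)[OF p(2) x] by auto
  note same = this
  show ?thesis
  proof (cases "m \<le> m'")
    case True
    show ?thesis
      by (rule image_of_cycle_max_determined[OF perm _ max m m'(2,3) True]) (use same in auto)
  next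
    case False
    then have le: "m' \<le> m" by simp
    show ?thesis
      by (rule image_of_cycle_max_determined[OF perm(2,1) _ max(2,1) m' m(2,3) le, symmetric]) (use same in auto)
  qed
qed

section \<open>The limits of the mean cycle counts and a bound on the number of cycles\<close>

context
  fixes q :: real
  assumes q: "0 < q" "q < 1"
begin

lemma orbit_mean_bounds:
  assumes "\<And>C. 0 \<le> \<phi> C" "\<And>C. \<phi> C \<le> 1"
  shows "0 \<le> orbit_mean q \<phi> a b" "orbit_mean q \<phi> a b \<le> 1"
proof -
  have pos: "0 \<le> mallows_prob {- int a..int b} q p" for p
    using mallows_prob_pos[OF q(1)] by (rule less_imp_le)
  show "0 \<le> orbit_mean q \<phi> a b"
    unfolding orbit_mean_def using pos assms by (intro sum_nonneg mult_nonneg_nonneg) auto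
  have "orbit_mean q \<phi> a b \<le> orbit_mean q (\<lambda>_. 1) a b"
    unfolding orbit_mean_def using pos assms by (intro sum_mono mult_left_mono) auto
  then show "orbit_mean q \<phi> a b \<le> 1" by (simp only: orbit_mean_1[OF q])
qed

lemma exp_cycles_tendsto:
  assumes "0 < i"
  shows "(\<lambda>n. exp_cycles q i n / real n) \<longlonglongrightarrow> cycle_prob q i / real i"
proof -
  let ?F = "orbit_mean q (\<lambda>C. of_bool (card C = i))"
  have "(\<lambda>n. (\<Sum>x<n. ?F x (n - 1 - x)) / real n) \<longlonglongrightarrow> cycle_prob q i"
  proof (rule cesaro_two_sided)
    show "((\<lambda>(a, b). ?F a b) \<longlongrightarrow> cycle_prob q i) (at_top \<times>\<^sub>F at_top)"
      unfolding cycle_prob_def by (rule orbit_mean_tendsto[OF q]) auto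
    show "\<bar>?F a b - cycle_prob q i\<bar> \<le> 1 + \<bar>cycle_prob q i\<bar>" for a b
      using orbit_mean_bounds[of "\<lambda>C. of_bool (card C = i)" a b] by auto
  qed
  then have "(\<lambda>n. (\<Sum>x<n. ?F x (n - 1 - x)) / real n / real i) \<longlonglongrightarrow> cycle_prob q i / real i"
    using assms by (intro tendsto_divide) auto
  then show ?thesis by (simp add: exp_cycles_eq_sum[OF assms] mult.commute)
qed

lemma mconst_eq: "0 < i \<Longrightarrow> mconst q i = cycle_prob q i / real i"
  unfolding mconst_def using exp_cycles_tendsto by (rule limI)

lemma mconst_nonneg:
  assumes "0 < i"
  shows "0 \<le> mconst q i"
proof -
  have "0 \<le> exp_cycles q i n / real n" for n
    unfolding exp_cycles_def using mallows_prob_pos[OF q(1)]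
    by (intro divide_nonneg_nonneg sum_nonneg mult_nonneg_nonneg) (auto intro: less_imp_le)
  then show ?thesis
    using exp_cycles_tendsto[OF assms] unfolding mconst_eq[OF assms] by (intro LIMSEQ_le_const) auto
qed

lemma prob_cycle_max_le:
  assumes x: "x \<in> {1..int n}"
  shows "(\<Sum>p | p permutes {1..int n}. mallows_prob {1..int n} q p * of_bool (x = Max (orb p x)))
    \<le> 1 / qint q (Suc n - nat x)"
proof -
  let ?A = "{1..int n}"
  \<comment> \<open>The condition is moved to words, where the bound for a determined letter
    applies; a word determines its permutation, so nothing is added. Position x has the zero-based
    index x - 1.\<close>
  define P where "P zs \<longleftrightarrow> (\<exists>p. p permutes ?A \<and> map p [1..int n] = zs \<and> x = Max (orb p x))" for zs
  have P: "P (map p [1..int n]) \<longleftrightarrow> x = Max (orb p x)" if "p permutes ?A" for p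
  proof -
    have "inj_on (\<lambda>p. map p [1..int n]) {p. p permutes ?A}"
      using bij_betw_permutes_lists[of "[1..int n]" ?A] by (simp add: bij_betw_def)
    then show ?thesis using that unfolding P_def by (auto dest: inj_onD)
  qed
  define k where "k = nat (x - 1)"
  have k: "k < card ?A" using x by (auto simp: k_def)
  have nth: "map p [1..int n] ! j = p (1 + int j)" if "j < n" for p j
    using that by simp
  have "(\<Sum>p | p permutes ?A. q ^ inv_count ?A p * of_bool (x = Max (orb p x)))
      = (\<Sum>p | p permutes ?A. if P (map p [1..int n]) then q ^ inv_count ?A p else 0)"
    using P by (intro sum.cong) auto
  also have "\<dots> = (\<Sum>zs\<in>permutations_of_set ?A. if P zs then q ^ list_inv zs else 0)"
    by (rule sum_inv_count_lists)
  also have "\<dots> \<le> qfact q (card ?A) / qint q (card ?A - k)"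
  proof (rule sum_list_inv_determined)
    fix zs zs' assume "P zs" "P zs'" and take: "take k zs = take k zs'"
    then obtain p p' where p: "p permutes ?A" "map p [1..int n] = zs" "x = Max (orb p x)"
      and p': "p' permutes ?A" "map p' [1..int n] = zs'" "x = Max (orb p' x)"
      unfolding P_def by blast
    have "p x = p' x"
    proof (rule image_of_cycle_max_eq[OF p(1) p'(1) x _ p(3) p'(3)])
      fix y assume y: "1 \<le> y" "y < x"
      define j where "j = nat (y - 1)"
      have "j < k" "j < n" using y x by (auto simp: j_def k_def)
      then have "zs ! j = zs' ! j" using take by (metis nth_take)
      then have "p (1 + int j) = p' (1 + int j)"
        using nth[OF \<open>j < n\<close>] p(2) p'(2) by metis
      then show "p y = p' y" using y by (simp add: j_def)
    qed
    moreover have "k < n" "1 + int k = x" using x by (auto simp: k_def)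
    ultimately show "zs ! k = zs' ! k" using nth[of k p] nth[of k p'] p(2) p'(2) by simp
  qed (use q k in auto)
  also have "card ?A - k = Suc n - nat x" using x by (simp add: k_def) linarith
  finally have "(\<Sum>p | p permutes ?A. q ^ inv_count ?A p * of_bool (x = Max (orb p x)))
      \<le> qfact q n / qint q (Suc n - nat x)" by simp
  then have "(\<Sum>p | p permutes ?A. q ^ inv_count ?A p * of_bool (x = Max (orb p x))) / qfact q n
      \<le> qfact q n / qint q (Suc n - nat x) / qfact q n"
    using qfact_pos[OF q(1), of n] by (intro divide_right_mono) auto
  then show ?thesis
    using qfact_pos[OF q(1), of n] by (simp add: mallows_prob_interval sum_divide_distrib del: sum_mult_of_bool_eq)
qed

text \<open>With t = q^m the claim (1 - q) / (1 - t) <= 1 - q + t amounts to t (q - t) >= 0. The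
  excess over 1 - q is geometric, so summing over m costs only a constant.\<close>

lemma inverse_qint_le:
  assumes "0 < m"
  shows "1 / qint q m \<le> (1 - q) + q ^ m"
proof -
  have m: "q ^ m \<le> q" using q assms by (cases m) (auto intro: mult_left_le power_le_one)
  have "qint q m = (1 - q ^ m) / (1 - q)"
    using qint_geometric[of q m] q by (simp add: field_simps)
  then have "1 / qint q m = (1 - q) / (1 - q ^ m)" by simp
  also have "\<dots> \<le> (1 - q) + q ^ m"
  proof -
    have "0 \<le> q ^ m * (q - q ^ m)" using m q by simp
    then have "1 - q \<le> ((1 - q) + q ^ m) * (1 - q ^ m)" by (simp add: algebra_simps)
    then show ?thesis using m q by (simp add: divide_le_eq)
  qed
  finally show ?thesis .
qed

text \<open>The expected number of cycles is at most n (1 - q) + 1 / (1 - q), uniformly in the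
  largest length k that is counted. Dividing by n and letting n grow with k fixed bounds every
  partial sum.\<close>

lemma sum_mconst_le: "(\<Sum>i<k. mconst q (Suc i)) \<le> 1 - q"
proof -
  have "(\<Sum>i<k. exp_cycles q (Suc i) n) \<le> real n * (1 - q) + 1 / (1 - q)" for n
  proof -
    let ?A = "{1..int n}"
    have "(\<Sum>i<k. exp_cycles q (Suc i) n)
        = (\<Sum>p | p permutes ?A. mallows_prob ?A q p * real (\<Sum>i<k. cycle_count (Suc i) ?A p))"
      unfolding exp_cycles_def by (subst sum.swap) (simp add: sum_distrib_left)
    also have "\<dots> \<le> (\<Sum>p | p permutes ?A. mallows_prob ?A q p * real (card {x \<in> ?A. x = Max (orb p x)}))"
      using mallows_prob_pos[OF q(1), of 1 "int n"]
      by (intro sum_mono mult_left_mono of_nat_mono sum_cycle_count_le) (auto intro: less_imp_le)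
    also have "\<dots> = (\<Sum>p | p permutes ?A. \<Sum>x\<in>?A. mallows_prob ?A q p * of_bool (x = Max (orb p x)))"
      by (simp only: card_eq_sum_of_bool finite_atLeastAtMost_int sum_distrib_left)
    also have "\<dots> = (\<Sum>x\<in>?A. \<Sum>p | p permutes ?A. mallows_prob ?A q p * of_bool (x = Max (orb p x)))"
      by (rule sum.swap)
    also have "\<dots> \<le> (\<Sum>x\<in>?A. 1 / qint q (Suc n - nat x))"
      by (intro sum_mono prob_cycle_max_le)
    also have "\<dots> = (\<Sum>j<n. 1 / qint q (Suc j))"
      by (rule sum.reindex_bij_witness[where j = "\<lambda>x. n - nat x" and i = "\<lambda>j. int (n - j)"])
        (auto simp: Suc_diff_le)
    also have "\<dots> \<le> (\<Sum>j<n. (1 - q) + q ^ Suc j)"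
      by (intro sum_mono inverse_qint_le) simp
    also have "\<dots> = real n * (1 - q) + q * qint q n"
      by (simp add: sum.distrib qint_def sum_distrib_left)
    also have "q * qint q n \<le> 1 * (1 / (1 - q))"
    proof (rule mult_mono)
      have "(1 - q) * qint q n \<le> 1" using q by (simp add: qint_geometric)
      then show "qint q n \<le> 1 / (1 - q)" using q by (simp add: field_simps)
    qed (use q qint_nonneg in auto)
    finally show ?thesis by simp
  qed
  note bound = this
  have "(\<lambda>n. \<Sum>i<k. exp_cycles q (Suc i) n / real n) \<longlonglongrightarrow> (\<Sum>i<k. mconst q (Suc i))"
    by (intro tendsto_sum) (simp only: mconst_eq exp_cycles_tendsto zero_less_Suc)
  moreover have "(\<lambda>n. (1 - q) + (1 / (1 - q)) / real n) \<longlonglongrightarrow> (1 - q) + 0"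
    by (intro tendsto_intros lim_const_over_n)
  moreover have "(\<Sum>i<k. exp_cycles q (Suc i) n / real n) \<le> (1 - q) + (1 / (1 - q)) / real n" if "n \<ge> 1" for n
    using divide_right_mono[OF bound[of n], of "real n"] that
    by (simp add: sum_divide_distrib add_divide_distrib)
  ultimately show ?thesis by (auto intro!: LIMSEQ_le)
qed

lemma mconst_sums: "(\<lambda>i. real (Suc i) * mconst q (Suc i)) sums 1"
  using cycle_prob_sums[OF q] by (simp add: mconst_eq)

end

section \<open>The fixed point density\<close>

lemma list_inv_insert:
  assumes "distinct (xs @ v # ys)"
  shows "list_inv (xs @ v # ys) = list_inv (xs @ ys) + length (filter (\<lambda>x. v < x) xs) + length (filter (\<lambda>y. y < v) ys)"
  using assms
proof (induction xs)
  case Nil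
  have "card {y \<in> set ys. y < v} = length (filter (\<lambda>y. y < v) ys)"
    using Nil distinct_card[of "filter (\<lambda>y. y < v) ys"] by simp
  then show ?case by simp
next
  case (Cons x xs)
  let ?A = "{y \<in> set (xs @ ys). y < x}"
  have "card {y \<in> set (xs @ v # ys). y < x} = card ?A + (if v < x then 1 else 0)"
  proof (cases "v < x")
    case True
    then have "{y \<in> set (xs @ v # ys). y < x} = insert v ?A" by auto
    moreover have "v \<notin> ?A" using Cons by auto
    ultimately show ?thesis using True by simp
  next
    case False
    then have "{y \<in> set (xs @ v # ys). y < x} = ?A" by auto
    then show ?thesis using False by simp
  qed
  moreover have "list_inv (xs @ v # ys) = list_inv (xs @ ys) + length (filter (\<lambda>x. v < x) xs) + length (filter (\<lambda>y. y < v) ys)"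
    using Cons by simp
  ultimately show ?case by simp
qed

lemma card_orb_eq_1_iff: "card (orb p x) = 1 \<longleftrightarrow> p x = x"
proof
  assume "card (orb p x) = 1"
  then obtain y where y: "orb p x = {y}" by (auto simp: card_1_singleton_iff)
  have "p x \<in> orb p x" unfolding orb_def by (auto intro!: exI[of _ 1])
  then show "p x = x" using y self_in_orb[of x p] by auto
next
  assume "p x = x"
  then have "(p ^^ k) x = x" for k by (induction k) auto
  then have "orb p x = {x}" by (auto simp: orb_def)
  then show "card (orb p x) = 1" by simp
qed

text \<open>The weight of the permutations of \<open>2n\<close> points that move exactly \<open>r\<close> points from the left half
  to the right half.\<close>

definition crossing_weight :: "real \<Rightarrow> nat \<Rightarrow> nat \<Rightarrow> real" where
  "crossing_weight q n r = block_weight q (n - r) r r (n - r)"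

text \<open>The k-th moment of X = q^R for the 2n points that remain once the origin is
  deleted.\<close>

definition crossing_moment :: "real \<Rightarrow> nat \<Rightarrow> nat \<Rightarrow> real" where
  "crossing_moment q k n = (\<Sum>r\<le>n. q ^ (k * r) * crossing_weight q n r) / qfact q (2 * n)"

context
  fixes q :: real
  assumes q: "0 < q" "q < 1"
begin

text \<open>The first n letters are the values on the left half; the negative values missing there
  number r, the crossings from left to right. Equally many cross back, so the four blocks have sizes
  \<alpha> = \<delta> = n - r and \<beta> = \<gamma> = r.\<close>

lemma sum_crossing:
  fixes g :: "nat \<Rightarrow> real" and n :: nat
  defines "B \<equiv> {- int n..int n} - {0}"
  shows "(\<Sum>zs\<in>permutations_of_set B. g (n - length (filter (\<lambda>x. x < 0) (take n zs))) * q ^ list_inv zs)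
    = (\<Sum>r\<le>n. g r * crossing_weight q n r)"
proof -
  have lo: "card {x \<in> B. x < 0} = n" and hi: "card {x \<in> B. \<not> x < 0} = n"
  proof -
    have "{x \<in> B. x < 0} = {- int n..<0}" "{x \<in> B. \<not> x < 0} = {0<..int n}" by (auto simp: B_def)
    then show "card {x \<in> B. x < 0} = n" "card {x \<in> B. \<not> x < 0} = n" by simp_all
  qed
  have fin: "finite B" by (simp add: B_def)
  have W: "crossing_weight q n r = (\<Sum>zs\<in>permutations_of_set B.
      if length (filter (\<lambda>x. x < 0) (take n zs)) = n - r then q ^ list_inv zs else 0)" if "r \<le> n" for r
    using sum_list_inv_split[OF q(1) fin, of 0 "n - r" r r "n - r"] lo hi that
    by (simp add: crossing_weight_def)
  have "(\<Sum>r\<le>n. g r * crossing_weight q n r)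
      = (\<Sum>r\<le>n. \<Sum>zs\<in>permutations_of_set B.
          g r * (if length (filter (\<lambda>x. x < 0) (take n zs)) = n - r then q ^ list_inv zs else 0))"
    unfolding sum_distrib_left[symmetric] by (intro sum.cong refl) (simp add: W)
  also have "\<dots> = (\<Sum>zs\<in>permutations_of_set B. \<Sum>r\<le>n.
          g r * (if length (filter (\<lambda>x. x < 0) (take n zs)) = n - r then q ^ list_inv zs else 0))"
    by (rule sum.swap)
  also have "\<dots> = (\<Sum>zs\<in>permutations_of_set B. g (n - length (filter (\<lambda>x. x < 0) (take n zs))) * q ^ list_inv zs)"
  proof (intro sum.cong refl)
    fix zs :: "int list"
    let ?a = "length (filter (\<lambda>x. x < 0) (take n zs))"
    have a: "?a \<le> n" using length_filter_le[of "\<lambda>x. x < 0" "take n zs"] by simp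
    have "(\<Sum>r\<le>n. g r * (if ?a = n - r then q ^ list_inv zs else 0))
        = (\<Sum>r\<le>n. if r = n - ?a then g r * q ^ list_inv zs else 0)"
      using a by (intro sum.cong refl) auto
    then show "(\<Sum>r\<le>n. g r * (if ?a = n - r then q ^ list_inv zs else 0)) = g (n - ?a) * q ^ list_inv zs"
      by (simp add: sum.delta)
  qed
  finally show ?thesis by simp
qed

text \<open>A fixed point at 0 is inverted with the r positive values to its left and with the r
  negative values to its right. Inserting it multiplies the weight by q^(2r), hence the second
  moment; \<open>qint q (2 * n + 1)\<close> is the ratio of the normalising q-factorials.\<close>

lemma orbit_mean_fixed_point:
  "orbit_mean q (\<lambda>C. of_bool (card C = 1)) n n = crossing_moment q 2 n / qint q (2 * n + 1)"
proof -
  define B where "B = {- int n..int n} - {0}"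
  let ?I = "{- int n..int n}"
  let ?c = "\<lambda>zs. n - length (filter (\<lambda>x. x < 0) (take n zs))"
  let ?ins = "\<lambda>zs. take n zs @ 0 # drop n zs"
  have cardB: "card B = 2 * n" by (simp add: B_def)
  have nth: "map p [- int n..int n] ! n = p 0" for p :: "int \<Rightarrow> int" by simp
  have "(\<Sum>p | p permutes ?I. if p 0 = 0 then q ^ inv_count ?I p else 0)
      = (\<Sum>zs\<in>permutations_of_set ?I. if zs ! n = 0 then q ^ list_inv zs else 0)"
    unfolding sum_inv_count_lists[symmetric] nth ..
  also have "\<dots> = (\<Sum>zs\<in>{zs \<in> permutations_of_set ?I. zs ! n = 0}. q ^ list_inv zs)"
    by (rule sum.inter_filter[symmetric]) simp
  also have "\<dots> = (\<Sum>zs\<in>permutations_of_set B. q ^ list_inv (?ins zs))"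
  proof (rule sum.reindex_bij_witness[where i = ?ins and j = "\<lambda>zs. take n zs @ drop (Suc n) zs"])
    fix zs assume zs: "zs \<in> {zs \<in> permutations_of_set ?I. zs ! n = 0}"
    then have len: "length zs = Suc (2 * n)" using length_finite_permutations_of_set[of zs ?I] by simp
    then have split: "zs = take n zs @ 0 # drop (Suc n) zs"
      using zs by (metis (mono_tags, lifting) id_take_nth_drop less_Suc_eq_le mem_Collect_eq mult_2 le_add1)
    show *: "?ins (take n zs @ drop (Suc n) zs) = zs"
      using len split by (simp add: min_def)
    then show "q ^ list_inv (?ins (take n zs @ drop (Suc n) zs)) = q ^ list_inv zs" by simp
    have "set zs = ?I" "distinct zs" using zs by (auto simp: permutations_of_set_def)
    then have "set (take n zs @ 0 # drop (Suc n) zs) = ?I" "distinct (take n zs @ 0 # drop (Suc n) zs)"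
      using split by auto
    then show "take n zs @ drop (Suc n) zs \<in> permutations_of_set B"
      unfolding B_def by (auto simp: permutations_of_set_def)
  next
    fix zs assume zs: "zs \<in> permutations_of_set B"
    then have len: "length zs = 2 * n" using length_finite_permutations_of_set[OF zs] cardB by simp
    show "take n (?ins zs) @ drop (Suc n) (?ins zs) = zs" using len by (simp add: min_def)
    have "set zs = B" "distinct zs" using zs by (auto simp: permutations_of_set_def)
    then have "set (take n zs @ drop n zs) = B" "distinct (take n zs @ drop n zs)" by simp_all
    then have "set (?ins zs) = ?I" "distinct (?ins zs)"
      unfolding B_def set_append distinct_append by auto
    moreover have "?ins zs ! n = 0" using len by (simp add: nth_append min_def)
    ultimately show "?ins zs \<in> {zs \<in> permutations_of_set ?I. zs ! n = 0}"
      by (auto simp: permutations_of_set_def)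
  qed
  also have "\<dots> = (\<Sum>zs\<in>permutations_of_set B. q ^ (2 * ?c zs) * q ^ list_inv zs)"
  proof (intro sum.cong refl)
    fix zs assume zs: "zs \<in> permutations_of_set B"
    then have len: "length zs = 2 * n" using length_finite_permutations_of_set[OF zs] cardB by simp
    have set: "set zs = B" and dist: "distinct zs" using zs by (auto simp: permutations_of_set_def)
    have setB: "x \<noteq> 0" if "x \<in> set (take n zs)" for x
      using that set_take_subset[of n zs] set by (auto simp: B_def)
    have "length (filter (\<lambda>x. x < 0) (take n zs)) + length (filter (\<lambda>x. \<not> x < 0) (take n zs)) = n"
      using len sum_length_filter_compl[of "\<lambda>x. x < 0" "take n zs"] by simp
    moreover have "filter (\<lambda>x. \<not> x < 0) (take n zs) = filter (\<lambda>x. 0 < x) (take n zs)"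
      using setB by (intro filter_cong) force+
    moreover have "length (filter (\<lambda>x. x < 0) (take n zs)) + length (filter (\<lambda>x. x < 0) (drop n zs)) = n"
    proof -
      have "length (filter (\<lambda>x. x < 0) zs) = card {x \<in> B. x < 0}"
        using distinct_card[of "filter (\<lambda>x. x < 0) zs"] dist set by simp
      also have "{x \<in> B. x < 0} = {- int n..<0}" by (auto simp: B_def)
      finally have "length (filter (\<lambda>x. x < 0) (take n zs @ drop n zs)) = n" by simp
      then show ?thesis by (simp only: filter_append length_append)
    qed
    ultimately have c: "length (filter (\<lambda>x. 0 < x) (take n zs)) = ?c zs"
      "length (filter (\<lambda>x. x < 0) (drop n zs)) = ?c zs" by simp_all
    have "distinct (take n zs @ drop n zs)" "0 \<notin> set (take n zs @ drop n zs)"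
      using dist set by (simp_all add: B_def)
    then have "distinct (take n zs @ 0 # drop n zs)"
      unfolding set_append distinct_append by auto
    then have "list_inv (?ins zs) = list_inv zs + ?c zs + ?c zs"
      using list_inv_insert[of "take n zs" 0 "drop n zs"] c by simp
    then show "q ^ list_inv (?ins zs) = q ^ (2 * ?c zs) * q ^ list_inv zs"
      by (simp add: power_add mult_2)
  qed
  also have "\<dots> = (\<Sum>r\<le>n. q ^ (2 * r) * crossing_weight q n r)"
    unfolding B_def by (rule sum_crossing)
  finally have S: "(\<Sum>p | p permutes ?I. if p 0 = 0 then q ^ inv_count ?I p else 0)
      = (\<Sum>r\<le>n. q ^ (2 * r) * crossing_weight q n r)" .
  have *: "nat (int n - - int n + 1) = Suc (2 * n)" by simp
  have "orbit_mean q (\<lambda>C. of_bool (card C = 1)) n n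
      = (\<Sum>p | p permutes ?I. (if p 0 = 0 then q ^ inv_count ?I p else 0) / qfact q (Suc (2 * n)))"
    unfolding orbit_mean_def mallows_prob_interval card_orb_eq_1_iff * by (intro sum.cong) auto
  also have "\<dots> = crossing_moment q 2 n / qint q (2 * n + 1)"
    unfolding sum_divide_distrib[symmetric] S by (simp add: crossing_moment_def qfact_Suc)
  finally show ?thesis .
qed

lemma crossing_weight_nonneg: "0 \<le> crossing_weight q n r"
  using less_imp_le[OF qfact_pos[OF q(1)]] q unfolding crossing_weight_def block_weight_def
  by (intro divide_nonneg_nonneg mult_nonneg_nonneg) auto

lemma crossing_moment_0: "crossing_moment q 0 n = 1"
proof -
  have "card ({- int n..int n} - {0}) = 2 * n" by simp
  then have "(\<Sum>r\<le>n. 1 * crossing_weight q n r) = qfact q (2 * n)"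
    unfolding sum_crossing[of "\<lambda>_. 1" n, symmetric] by (simp add: sum_list_inv)
  then show ?thesis using qfact_pos[OF q(1), of "2 * n"] by (simp add: crossing_moment_def)
qed

text \<open>For r <= n the weight is \<open>q ^ (r * r) * qfact q n ^ 4 / (qfact q r * qfact q (n -
  r)) ^ 2\<close>, a q-analogue of the hypergeometric law. Hence consecutive weights have an
  explicit ratio; clearing denominators and multiplying by (1 - q)^2 turns the q-integers into 1 -
  q^j.\<close>

lemma crossing_weight_ratio:
  assumes "r < n"
  shows "crossing_weight q n (Suc r) * (1 - q ^ Suc r)\<^sup>2
    = crossing_weight q n r * (q ^ Suc (2 * r) * (1 - q ^ (n - r))\<^sup>2)"
proof -
  obtain m where n: "n = Suc (r + m)" using assms less_iff_Suc_add by auto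
  have nz: "qfact q k \<noteq> 0" "qint q (Suc k) \<noteq> 0" "1 - q \<noteq> 0" for k
    using qfact_pos[OF q(1), of k] qint_pos[OF q(1), of "Suc k"] q by auto
  have "crossing_weight q n (Suc r) * (qint q (Suc r))\<^sup>2
      = crossing_weight q n r * (q ^ Suc (2 * r) * (qint q (Suc m))\<^sup>2)"
    using nz unfolding n
    by (simp add: crossing_weight_def block_weight_def qfact_Suc power2_eq_square divide_simps power_add mult_2)
  then have "(1 - q)\<^sup>2 * (crossing_weight q n (Suc r) * (qint q (Suc r))\<^sup>2)
      = (1 - q)\<^sup>2 * (crossing_weight q n r * (q ^ Suc (2 * r) * (qint q (Suc m))\<^sup>2))"
    by (simp only:)
  then have "crossing_weight q n (Suc r) * ((1 - q) * qint q (Suc r))\<^sup>2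
      = crossing_weight q n r * (q ^ Suc (2 * r) * ((1 - q) * qint q (Suc m))\<^sup>2)"
    unfolding power_mult_distrib by (simp only: mult_ac)
  then show ?thesis unfolding qint_geometric by (simp add: n Suc_diff_le)
qed

text \<open>The ratio of consecutive weights, multiplied by q^(k(r+1)) and summed over r, reads
  E[X^k (1 - X)^2] = q^(k+1) E[X^k (X - q^n)^2]; both squares are expanded into moments.\<close>

lemma crossing_moment_identity:
  "crossing_moment q k n - 2 * crossing_moment q (Suc k) n + crossing_moment q (Suc (Suc k)) n
    = q ^ Suc k * (crossing_moment q (Suc (Suc k)) n - 2 * q ^ n * crossing_moment q (Suc k) n
        + (q ^ n)\<^sup>2 * crossing_moment q k n)"
proof -
  let ?W = "crossing_weight q n" and ?Z = "qfact q (2 * n)"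
  have pw: "q ^ (Suc k * r) = q ^ (k * r) * q ^ r" "q ^ (Suc (Suc k) * r) = q ^ (k * r) * (q ^ r)\<^sup>2" for k r
    by (simp_all add: power_add power2_eq_square)
  have "crossing_moment q k n - 2 * crossing_moment q (Suc k) n + crossing_moment q (Suc (Suc k)) n
      = (\<Sum>r\<le>n. q ^ (k * r) * (1 - q ^ r)\<^sup>2 * ?W r) / ?Z"
    unfolding crossing_moment_def pw
    by (simp add: power2_eq_square algebra_simps sum.distrib sum_subtractf sum_distrib_left diff_divide_distrib add_divide_distrib)
  \<comment> \<open>The term r = 0 vanishes because of 1 - q^0 = 0, so the index can be
    shifted.\<close>
  also have "(\<Sum>r\<le>n. q ^ (k * r) * (1 - q ^ r)\<^sup>2 * ?W r)
      = (\<Sum>r<n. q ^ (k * Suc r) * (?W (Suc r) * (1 - q ^ Suc r)\<^sup>2))"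
    unfolding sum.atMost_shift by (simp add: mult_ac del: power_Suc mult_Suc_right)
  also have "\<dots> = (\<Sum>r<n. q ^ Suc k * (q ^ (k * r) * (q ^ r - q ^ n)\<^sup>2 * ?W r))"
  proof (intro sum.cong refl)
    fix r assume "r \<in> {..<n}"
    then have r: "r < n" by simp
    have "q ^ n = q ^ r * q ^ (n - r)" using r by (simp flip: power_add)
    then have "(q ^ r - q ^ n)\<^sup>2 = (q ^ r)\<^sup>2 * (1 - q ^ (n - r))\<^sup>2"
      by (simp add: algebra_simps flip: power_mult_distrib)
    moreover have "q ^ Suc (2 * r) = q * (q ^ r)\<^sup>2" by (simp add: power_mult[symmetric] mult.commute)
    moreover have "q ^ (k * Suc r) = q ^ (k * r) * q ^ k" by (simp add: power_add)
    ultimately show "q ^ (k * Suc r) * (?W (Suc r) * (1 - q ^ Suc r)\<^sup>2)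
        = q ^ Suc k * (q ^ (k * r) * (q ^ r - q ^ n)\<^sup>2 * ?W r)"
      unfolding crossing_weight_ratio[OF r] by (simp only: power_Suc mult_ac)
  qed
  \<comment> \<open>The term r = n may be added, since it contains q^n - q^n.\<close>
  also have "\<dots> = (\<Sum>r\<le>n. q ^ Suc k * (q ^ (k * r) * (q ^ r - q ^ n)\<^sup>2 * ?W r))"
    by (simp flip: lessThan_Suc_atMost)
  also have "\<dots> / ?Z = q ^ Suc k * (crossing_moment q (Suc (Suc k)) n - 2 * q ^ n * crossing_moment q (Suc k) n
        + (q ^ n)\<^sup>2 * crossing_moment q k n)"
    unfolding crossing_moment_def pw
    by (simp add: power2_eq_square algebra_simps sum.distrib sum_subtractf sum_distrib_left diff_divide_distrib add_divide_distrib)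
  finally show ?thesis .
qed

lemma crossing_moment_mono:
  assumes "\<And>r. q ^ (k * r) \<le> q ^ (l * r) + d"
  shows "crossing_moment q k n \<le> crossing_moment q l n + d"
proof -
  \<comment> \<open>The factor q^(0r) = 1 turns the error into d times the zeroth moment, which is
    1.\<close>
  have "(\<Sum>r\<le>n. q ^ (k * r) * crossing_weight q n r)
      \<le> (\<Sum>r\<le>n. (q ^ (l * r) + d * q ^ (0 * r)) * crossing_weight q n r)"
    using assms crossing_weight_nonneg by (intro sum_mono mult_right_mono) auto
  then have "crossing_moment q k n
      \<le> (\<Sum>r\<le>n. (q ^ (l * r) + d * q ^ (0 * r)) * crossing_weight q n r) / qfact q (2 * n)"
    unfolding crossing_moment_def
    using less_imp_le[OF qfact_pos[OF q(1)]] by (intro divide_right_mono) auto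
  also have "\<dots> = crossing_moment q l n + d * crossing_moment q 0 n"
    unfolding crossing_moment_def
    by (simp add: algebra_simps sum.distrib sum_distrib_left add_divide_distrib)
  finally show ?thesis by (simp add: crossing_moment_0)
qed

lemma crossing_moment_bounds: "0 \<le> crossing_moment q k n" "crossing_moment q k n \<le> 1"
proof -
  show "0 \<le> crossing_moment q k n"
    unfolding crossing_moment_def
    using q crossing_weight_nonneg less_imp_le[OF qfact_pos[OF q(1)]]
    by (intro divide_nonneg_nonneg sum_nonneg mult_nonneg_nonneg) auto
  show "crossing_moment q k n \<le> 1"
    using crossing_moment_mono[of k 0 0 n] q by (simp add: crossing_moment_0 power_le_one)
qed

lemma crossing_moment_2_tendsto: "(\<lambda>n. crossing_moment q 2 n) \<longlonglongrightarrow> mconst q 1 / (1 - q)"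
proof -
  have "filterlim (\<lambda>n::nat. (n, n)) (at_top \<times>\<^sub>F at_top) at_top"
    by (intro filterlim_Pair filterlim_ident)
  from filterlim_compose[OF orbit_mean_tendsto[OF q, of "\<lambda>C. of_bool (card C = 1)"] this]
  have "(\<lambda>n. orbit_mean q (\<lambda>C. of_bool (card C = 1)) n n) \<longlonglongrightarrow> mconst q 1"
    using mconst_eq[OF q, of 1] by (simp add: cycle_prob_def)
  then have 1: "(\<lambda>n. crossing_moment q 2 n / qint q (2 * n + 1)) \<longlonglongrightarrow> mconst q 1"
    by (simp only: orbit_mean_fixed_point)
  have "filterlim (\<lambda>n::nat. 2 * n + 1) at_top at_top"
    by (rule filterlim_subseq) (simp add: strict_mono_def)
  then have "(\<lambda>n. q ^ (2 * n + 1)) \<longlonglongrightarrow> 0"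
    by (rule filterlim_compose[OF LIMSEQ_power_zero, rotated]) (use q in simp)
  then have "(\<lambda>n. (1 - q ^ (2 * n + 1)) / (1 - q)) \<longlonglongrightarrow> (1 - 0) / (1 - q)"
    using q by (intro tendsto_intros) auto
  moreover have "(1 - q ^ (2 * n + 1)) / (1 - q) = qint q (2 * n + 1)" for n
    using qint_geometric[of q "2 * n + 1"] q by (simp add: field_simps)
  ultimately have "(\<lambda>n. qint q (2 * n + 1)) \<longlonglongrightarrow> 1 / (1 - q)" by (simp only: diff_zero)
  note lim = tendsto_mult[OF 1 this]
  have "qint q (2 * n + 1) \<noteq> 0" for n using qint_pos[OF q(1), of "2 * n + 1"] by simp
  then have "crossing_moment q 2 n / qint q (2 * n + 1) * qint q (2 * n + 1) = crossing_moment q 2 n" for n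
    by simp
  with lim show ?thesis by (simp only: times_divide_eq_right mult_1_right)
qed

text \<open>In the limit \<open>n \<rightarrow> \<infinity>\<close> the identities for \<open>k = 0, 1\<close> determine the first moment through the second
  and the second through the third.\<close>

lemma mconst_1_equation:
  defines "a \<equiv> mconst q 1 / (1 - q)"
  obtains a3 where "4 * a = 1 + (1 - q) * a + 2 * (1 - q\<^sup>2) * a3"
    "a \<le> a3 + q\<^sup>2" "0 \<le> a3" "a3 \<le> a" "a \<le> 1"
proof -
  let ?A = "\<lambda>k n. crossing_moment q k n"
  have A2: "?A 2 \<longlonglongrightarrow> a" unfolding a_def by (rule crossing_moment_2_tendsto)
  have qn: "(\<lambda>n. q ^ n) \<longlonglongrightarrow> 0" using q by (intro LIMSEQ_power_zero) auto
  have ne: "2 - 2 * q * q ^ n \<noteq> 0" for n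
  proof -
    have "q * q ^ n < 1" using q by (metis power_Suc power_Suc_less_one)
    moreover have "2 * q * q ^ n = 2 * (q * q ^ n)" by simp
    ultimately show ?thesis by linarith
  qed
  \<comment> \<open>So far only the second moment is known to converge. Solving the identity for k =
    0 at finite n expresses the first moment through it and so proves that the first moment
    converges too; \<open>eq3\<close> does the same for the third.\<close>
  have eq1: "?A 1 n = (1 + (1 - q) * ?A 2 n - q * (q ^ n)\<^sup>2) / (2 - 2 * q * q ^ n)" for n
  proof -
    have "1 - 2 * ?A 1 n + ?A 2 n = q * (?A 2 n - 2 * q ^ n * ?A 1 n + (q ^ n)\<^sup>2)"
      using crossing_moment_identity[of 0 n] by (simp add: crossing_moment_0 numeral_2_eq_2)
    then have "?A 1 n * (2 - 2 * q * q ^ n) = 1 + (1 - q) * ?A 2 n - q * (q ^ n)\<^sup>2"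
      by (simp add: algebra_simps)
    then show ?thesis using ne[of n] by (metis nonzero_eq_divide_eq)
  qed
  have "(\<lambda>n. (1 + (1 - q) * ?A 2 n - q * (q ^ n)\<^sup>2) / (2 - 2 * q * q ^ n))
      \<longlonglongrightarrow> (1 + (1 - q) * a - q * 0\<^sup>2) / (2 - 2 * q * 0)"
    by (intro tendsto_intros A2 qn) auto
  then have A1: "?A 1 \<longlonglongrightarrow> (1 + (1 - q) * a) / 2" unfolding eq1[symmetric] by simp
  have q2: "1 - q\<^sup>2 \<noteq> 0" using q by (simp add: power2_eq_1_iff)
  have eq3: "?A 3 n = (2 * ?A 2 n - ?A 1 n - 2 * q\<^sup>2 * q ^ n * ?A 2 n + q\<^sup>2 * (q ^ n)\<^sup>2 * ?A 1 n) / (1 - q\<^sup>2)" for n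
  proof -
    have "?A 1 n - 2 * ?A 2 n + ?A 3 n
        = q\<^sup>2 * (?A 3 n - 2 * q ^ n * ?A 2 n + (q ^ n)\<^sup>2 * ?A 1 n)"
      using crossing_moment_identity[of 1 n] by (simp add: numeral_2_eq_2 numeral_3_eq_3)
    then have "?A 3 n * (1 - q\<^sup>2)
        = 2 * ?A 2 n - ?A 1 n - 2 * q\<^sup>2 * q ^ n * ?A 2 n + q\<^sup>2 * (q ^ n)\<^sup>2 * ?A 1 n"
      by (simp add: algebra_simps)
    then show ?thesis using q2 by (metis nonzero_eq_divide_eq)
  qed
  \<comment> \<open>The zeros are the limit of q^n, kept in place so that the limit laws apply to
    \<open>eq3\<close> term by term.\<close>
  define a3 where "a3 = (2 * a - (1 + (1 - q) * a) / 2 - 2 * q\<^sup>2 * 0 * a + q\<^sup>2 * 0\<^sup>2 * ((1 + (1 - q) * a) / 2)) / (1 - q\<^sup>2)"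
  have A3: "?A 3 \<longlonglongrightarrow> a3"
    unfolding eq3 a3_def by (intro tendsto_intros A1 A2 qn q2)
  have "4 * a = 1 + (1 - q) * a + 2 * (1 - q\<^sup>2) * a3"
  proof -
    have "(1 - q\<^sup>2) * a3 = 2 * a - (1 + (1 - q) * a) / 2" using q2 by (simp add: a3_def)
    then show ?thesis unfolding mult.assoc by (simp add: add_divide_distrib)
  qed
  \<comment> \<open>X is 1 when r = 0 and at most q otherwise; so X^2 - X^3 is 0 or at most X^2 <=
    q^2.\<close>
  moreover have "a \<le> a3 + q\<^sup>2"
  proof (rule LIMSEQ_le[OF A2 tendsto_add[OF A3 tendsto_const]], intro exI allI impI)
    show "?A 2 n \<le> ?A 3 n + q\<^sup>2" for n
    proof (rule crossing_moment_mono)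
      fix r show "q ^ (2 * r) \<le> q ^ (3 * r) + q\<^sup>2"
      proof (cases r)
        case (Suc m)
        have "q ^ (2 * r) \<le> q\<^sup>2" using q Suc by (intro power_decreasing) auto
        then show ?thesis using q by (smt (verit) zero_le_power)
      qed simp
    qed
  qed
  moreover have "0 \<le> a3" by (rule LIMSEQ_le_const[OF A3]) (use crossing_moment_bounds in auto)
  moreover have "a3 \<le> a"
  proof (rule LIMSEQ_le[OF A3 A2], intro exI allI impI)
    show "?A 3 n \<le> ?A 2 n" for n
      using crossing_moment_mono[of 3 2 0 n] q by (simp add: power_decreasing)
  qed
  moreover have "a \<le> 1" by (rule LIMSEQ_le_const2[OF A2]) (use crossing_moment_bounds in auto)
  ultimately show ?thesis by (rule that)
qed

text \<open>In the equation for 4a both terms besides 1 carry a factor of order 1 - q and bounded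
  moments; hence a = 1/4 + O(1 - q), and \<open>mconst q 1\<close> is (1 - q) a.\<close>

lemma mconst_1_near_1: "\<bar>mconst q 1 - (1 - q) / 4\<bar> \<le> 2 * (1 - q)\<^sup>2"
proof -
  define a where "a = mconst q 1 / (1 - q)"
  obtain a3 where a: "4 * a = 1 + (1 - q) * a + 2 * (1 - q\<^sup>2) * a3"
    "a \<le> a3 + q\<^sup>2" "0 \<le> a3" "a3 \<le> a" "a \<le> 1"
    using mconst_1_equation unfolding a_def by blast
  have "0 \<le> (1 - q) * a" "(1 - q) * a \<le> (1 - q) * 1" using a q by (auto intro!: mult_left_mono)
  moreover have "0 \<le> (1 - q\<^sup>2) * a3" "(1 - q\<^sup>2) * a3 \<le> (2 * (1 - q)) * 1"
  proof -
    have "1 - q\<^sup>2 = (1 + q) * (1 - q)" by (simp add: power2_eq_square algebra_simps)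
    moreover have "(1 + q) * (1 - q) \<le> 2 * (1 - q)" "0 \<le> (1 + q) * (1 - q)"
      using q by (auto intro: mult_right_mono simp del: distrib_right_numeral right_diff_distrib_numeral)
    ultimately have "1 - q\<^sup>2 \<le> 2 * (1 - q)" "0 \<le> 1 - q\<^sup>2" by simp_all
    then show "0 \<le> (1 - q\<^sup>2) * a3" "(1 - q\<^sup>2) * a3 \<le> (2 * (1 - q)) * 1"
      using a q mult_mono[of "1 - q\<^sup>2" "2 * (1 - q)" a3 1] by simp_all
  qed
  ultimately have "\<bar>a - 1 / 4\<bar> \<le> 2 * (1 - q)" using a(1) q by linarith
  then have "(1 - q) * \<bar>a - 1 / 4\<bar> \<le> (1 - q) * (2 * (1 - q))" using q by (intro mult_left_mono) auto
  moreover have "mconst q 1 - (1 - q) / 4 = (1 - q) * (a - 1 / 4)"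
    using q by (simp add: a_def field_simps)
  ultimately show ?thesis using q by (simp add: abs_mult power2_eq_square)
qed

lemma mconst_1_near_0: "\<bar>mconst q 1 - (1 - 2 * q)\<bar> \<le> 6 * q\<^sup>2"
proof -
  define a where "a = mconst q 1 / (1 - q)"
  obtain a3 where a: "4 * a = 1 + (1 - q) * a + 2 * (1 - q\<^sup>2) * a3"
    "a \<le> a3 + q\<^sup>2" "0 \<le> a3" "a3 \<le> a" "a \<le> 1"
    using mconst_1_equation unfolding a_def by blast
  have m: "mconst q 1 = (1 - q) * a" using q by (simp add: a_def)
  have q2: "0 \<le> 1 - q\<^sup>2" using q by (simp add: power_le_one)
  \<comment> \<open>Replacing a3 by a in the equation gives a D = 1. The bounds a - q^2 <= a3 <= a
    therefore place a D between 1 - 2 q^2 and 1.\<close>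
  let ?D = "1 + q + 2 * q\<^sup>2"
  have D: "1 \<le> ?D" using q by simp
  have "(1 - q\<^sup>2) * a3 \<le> (1 - q\<^sup>2) * a" using a q2 by (intro mult_left_mono) auto
  then have 1: "a * ?D \<le> 1" using a(1) by (simp add: algebra_simps)
  have "(1 - q\<^sup>2) * (a - q\<^sup>2) \<le> (1 - q\<^sup>2) * a3" using a q2 by (intro mult_left_mono) auto
  moreover have "(1 - q\<^sup>2) * (a - q\<^sup>2) = a - q\<^sup>2 - a * q\<^sup>2 + q\<^sup>2 * q\<^sup>2" by (simp add: algebra_simps)
  moreover have "0 \<le> q\<^sup>2 * q\<^sup>2" by simp
  moreover have "4 * a = 1 + (a - a * q) + 2 * ((1 - q\<^sup>2) * a3)" using a(1) by (simp add: algebra_simps)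
  moreover have "1 - 2 * s \<le> a + b + 2 * c"
    if "Y \<le> X" "Y = a - s - c + d" "0 \<le> d" "4 * a = 1 + (a - b) + 2 * X" for s b c d X Y :: real
    using that by linarith
  ultimately have "1 - 2 * q\<^sup>2 \<le> a + a * q + 2 * (a * q\<^sup>2)" by blast
  then have 2: "1 - 2 * q\<^sup>2 \<le> a * ?D" by (simp add: algebra_simps)
  have q3: "0 \<le> q * q\<^sup>2" "q * q\<^sup>2 \<le> q\<^sup>2" using q by (auto intro: mult_left_le_one_le)
  \<comment> \<open>The expansion 1 - 2q of (1 - q) / D is checked after multiplication by D, where
    it leaves only a cubic error; since D >= 1, the bound survives dropping D again.\<close>
  have e: "(1 - 2 * q) * ?D = 1 - q - 4 * (q * q\<^sup>2)" by (simp add: algebra_simps power2_eq_square)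
  have "mconst q 1 * ?D = (1 - q) * (a * ?D)" by (simp only: m mult.assoc)
  moreover have "(1 - q) * (a * ?D) \<le> (1 - q) * 1" "(1 - q) * (1 - 2 * q\<^sup>2) \<le> (1 - q) * (a * ?D)"
    using 1 2 q by (auto intro!: mult_left_mono)
  moreover have "(1 - q) * (1 - 2 * q\<^sup>2) = 1 - q - 2 * q\<^sup>2 + 2 * (q * q\<^sup>2)" by (simp add: algebra_simps)
  ultimately have "\<bar>(mconst q 1 - (1 - 2 * q)) * ?D\<bar> \<le> 6 * q\<^sup>2"
    using e q3 unfolding left_diff_distrib by linarith
  moreover have "\<bar>mconst q 1 - (1 - 2 * q)\<bar> * 1 \<le> \<bar>mconst q 1 - (1 - 2 * q)\<bar> * ?D"
    using D by (intro mult_left_mono) auto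
  ultimately show ?thesis using D by (simp add: abs_mult)
qed

end

section \<open>The bi-infinite Mallows measure\<close>

text \<open>Cycle length i > 0 is a condition on the first i iterates alone. This gives both the
  measurability of the event and its stability under pointwise convergence. An infinite orbit has
  \<open>card\<close> equal to 0 and so never matches such an i.\<close>

lemma card_orb_eq_iff:
  assumes inj: "inj f" and i: "0 < i"
  shows "card (orb f x) = i \<longleftrightarrow> (f ^^ i) x = x \<and> (\<forall>j. 0 < j \<longrightarrow> j < i \<longrightarrow> (f ^^ j) x \<noteq> x)"
proof -
  have cancel: "(f ^^ (b - a)) x = x" if "(f ^^ a) x = (f ^^ b) x" "a < b" for a b
  proof -
    have "(f ^^ a) ((f ^^ (b - a)) x) = (f ^^ a) x"
      using that by (metis add_diff_inverse_nat comp_apply funpow_add less_imp_not_less)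
    then show ?thesis using inj_fn[OF inj, of a] by (simp add: inj_eq)
  qed
  have card: "card (orb f x) = m"
    if m: "0 < m" "(f ^^ m) x = x" and least: "\<And>j. 0 < j \<Longrightarrow> j < m \<Longrightarrow> (f ^^ j) x \<noteq> x" for m
  proof -
    have "x \<in> orbit f x" using m unfolding orbit_altdef by (auto intro!: exI[of _ m])
    then have "orb f x = (\<lambda>j. (f ^^ j) x) ` {..<m}"
      using orbit_altdef_bounded[OF m(2,1)] orbit_altdef_self_in[of x f] by (auto simp: orb_def)
    moreover have "inj_on (\<lambda>j. (f ^^ j) x) {..<m}"
    proof (rule linorder_inj_onI)
      fix a b assume "a < b" "a \<in> {..<m}" "b \<in> {..<m}"
      then show "(f ^^ a) x \<noteq> (f ^^ b) x"
        using cancel[of a b] least[of "b - a"] by auto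
    qed auto
    ultimately show ?thesis by (simp add: card_image)
  qed
  show ?thesis
  proof
    assume c: "card (orb f x) = i"
    then have "finite (range (\<lambda>k. (f ^^ k) x))"
      using i card_ge_0_finite[of "orb f x"] by (simp add: orb_def full_SetCompr_eq)
    then have "\<not> inj (\<lambda>k. (f ^^ k) x)" using finite_imageD infinite_UNIV_nat by blast
    then obtain a b where "a < b" "(f ^^ a) x = (f ^^ b) x"
      unfolding inj_def by (metis linorder_neqE_nat)
    then have ex: "0 < b - a \<and> (f ^^ (b - a)) x = x" using cancel by simp
    define m where "m = (LEAST m. 0 < m \<and> (f ^^ m) x = x)"
    have m: "0 < m \<and> (f ^^ m) x = x" unfolding m_def by (rule LeastI[of _ "b - a"]) (rule ex)
    have least: "(f ^^ j) x \<noteq> x" if "0 < j" "j < m" for j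
      using not_less_Least[OF that(2)[unfolded m_def]] that(1) by simp
    have "m = i" using card[OF conjunct1[OF m] conjunct2[OF m] least] c by simp
    then show "(f ^^ i) x = x \<and> (\<forall>j. 0 < j \<longrightarrow> j < i \<longrightarrow> (f ^^ j) x \<noteq> x)"
      using m least by simp
  next
    assume "(f ^^ i) x = x \<and> (\<forall>j. 0 < j \<longrightarrow> j < i \<longrightarrow> (f ^^ j) x \<noteq> x)"
    then show "card (orb f x) = i" using card[of i] i by blast
  qed
qed

lemma funpow_eventually_eq:
  fixes f :: "'b \<Rightarrow> 'b"
  assumes "\<And>y. eventually (\<lambda>n. g n y = f y) F"
  shows "eventually (\<lambda>n. (g n ^^ k) x = (f ^^ k) x) F"
proof (induction k)
  case (Suc k)
  from Suc.IH assms[of "(f ^^ k) x"] show ?case by eventually_elim simp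
qed simp

text \<open>Only the iterates up to i matter, and each of these finitely many eventually agrees with
  its limit.\<close>

lemma card_orb_eventually_eq:
  assumes "\<And>y. eventually (\<lambda>n. g n y = f y) F" "\<And>n. inj (g n)" "inj f" "0 < i"
  shows "eventually (\<lambda>n. card (orb (g n) x) = i \<longleftrightarrow> card (orb f x) = i) F"
proof -
  have "eventually (\<lambda>n. \<forall>k\<in>{..i}. (g n ^^ k) x = (f ^^ k) x) F"
    by (intro eventually_ball_finite ballI funpow_eventually_eq assms) simp
  then show ?thesis
    by eventually_elim (simp add: card_orb_eq_iff assms)
qed

lemma measurable_funpow_countable:
  fixes f :: "'c \<Rightarrow> 'b \<Rightarrow> 'b::countable"
  assumes "\<And>i. (\<lambda>w. f w i) \<in> measurable M (count_space UNIV)"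
  shows "(\<lambda>w. (f w ^^ k) x) \<in> measurable M (count_space UNIV)"
proof (induction k)
  case (Suc k)
  have "(\<lambda>w. f w ((f w ^^ k) x)) \<in> measurable M (count_space UNIV)"
    by (rule measurable_compose_countable[where f = "\<lambda>i w. f w i", OF assms Suc])
  then show ?case by simp
qed simp

context
  fixes q :: real and M :: "'a measure" and Sg :: "'a \<Rightarrow> int \<Rightarrow> int"
  assumes q: "0 < q" "q < 1" and mZ: "mallows_Z M q Sg"
begin

interpretation prob_space M
  using mZ by (simp add: mallows_Z_def)

lemma pattern_prob:
  assumes "p permutes {- int n..int n}"
  shows "measure M {w \<in> space M. pattern (Sg w) {- int n..int n} = p} = mallows_prob {- int n..int n} q p"
  using mZ assms by (simp add: mallows_Z_def)

text \<open>The patterns have positive measure, hence these sets are measurable: \<open>measure\<close> is \<open>0\<close> on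
  sets outside the sigma-algebra.\<close>

lemma pattern_sets:
  assumes "p permutes {- int n..int n}"
  shows "{w \<in> space M. pattern (Sg w) {- int n..int n} = p} \<in> sets M"
proof (rule ccontr)
  assume "\<not> ?thesis"
  then have "measure M {w \<in> space M. pattern (Sg w) {- int n..int n} = p} = 0"
    by (rule measure_notin_sets)
  then show False using pattern_prob[OF assms] mallows_prob_pos[OF q(1)] by (metis less_irrefl)
qed

lemma pattern_prob_Collect:
  shows "{w \<in> space M. pattern (Sg w) {- int n..int n} permutes {- int n..int n} \<and> Q (pattern (Sg w) {- int n..int n})} \<in> sets M"
      (is "?S \<in> sets M")
    and "measure M {w \<in> space M. pattern (Sg w) {- int n..int n} permutes {- int n..int n} \<and> Q (pattern (Sg w) {- int n..int n})}
      = (\<Sum>p | p permutes {- int n..int n}. mallows_prob {- int n..int n} q p * of_bool (Q p))"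
proof -
  let ?I = "{- int n..int n}"
  let ?P = "{p. p permutes ?I \<and> Q p}"
  let ?E = "\<lambda>p. {w \<in> space M. pattern (Sg w) ?I = p}"
  have fin: "finite ?P" by (rule finite_subset[OF _ finite_permutes_interval[of "- int n" "int n"]]) auto
  have S: "?S = (\<Union>p\<in>?P. ?E p)" by auto
  show "?S \<in> sets M" unfolding S using fin pattern_sets by (intro sets.finite_UN) auto
  have "measure M ?S = (\<Sum>p\<in>?P. measure M (?E p))"
    unfolding S using fin pattern_sets
    by (intro finite_measure_finite_Union) (auto simp: disjoint_family_on_def)
  also have "\<dots> = (\<Sum>p\<in>?P. mallows_prob ?I q p)"
    by (intro sum.cong refl pattern_prob) simp
  also have "\<dots> = (\<Sum>p | p permutes ?I. mallows_prob ?I q p * of_bool (Q p))"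
    using fin by (intro sum.mono_neutral_cong_left) auto
  finally show "measure M ?S = (\<Sum>p | p permutes ?I. mallows_prob ?I q p * of_bool (Q p))" .
qed

text \<open>The probabilities prescribed for the permutations of the interval sum to 1, so almost
  surely the pattern is one of them.\<close>

lemma AE_pattern_permutes: "AE w in M. \<forall>n. pattern (Sg w) {- int n..int n} permutes {- int n..int n}"
  unfolding AE_all_countable
proof
  fix n
  let ?I = "{- int n..int n}"
  have "prob {w \<in> space M. pattern (Sg w) ?I permutes ?I \<and> True} = 1"
    using pattern_prob_Collect(2)[of n "\<lambda>_. True"] sum_mallows_prob[OF q(1), of "- int n" "int n"] by simp
  then show "AE w in M. pattern (Sg w) ?I permutes ?I"
    using prob_Collect_eq_1[of "\<lambda>w. pattern (Sg w) ?I permutes ?I"] pattern_prob_Collect(1)[of n "\<lambda>_. True"]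
    by simp
qed

text \<open>The centred window mean is the probability that 0 lies in an i-cycle of the pattern on
  {-n..n}. The patterns converge pointwise to Sigma almost surely, so the indicators of these events
  converge, and dominated convergence with the constant 1 identifies the limit.\<close>

lemma prob_card_orb:
  assumes i: "0 < i"
  shows "measure M {w \<in> space M. card (orb (Sg w) 0) = i} = cycle_prob q i"
proof -
  let ?I = "\<lambda>n. {- int n..int n}"
  let ?pat = "\<lambda>n w. pattern (Sg w) (?I n)"
  define D where "D = {w \<in> space M. card (orb (Sg w) 0) = i}"
  define E where "E n = {w \<in> space M. ?pat n w permutes ?I n \<and> card (orb (?pat n w) 0) = i}" for n
  have inj: "inj (Sg w)" if "w \<in> space M" for w
    using mZ that by (simp add: mallows_Z_def bij_is_inj)
  have iter: "{w \<in> space M. (Sg w ^^ k) 0 = 0} \<in> sets M" for k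
  proof -
    have "(\<lambda>w. (Sg w ^^ k) 0) \<in> measurable M (count_space UNIV)"
      by (rule measurable_funpow_countable) (use mZ in \<open>simp add: mallows_Z_def\<close>)
    from measurable_sets[OF this, of "{0}"] show ?thesis by (simp add: vimage_def Int_def conj_commute)
  qed
  have "D = {w \<in> space M. (Sg w ^^ i) 0 = 0} - (\<Union>j\<in>{0<..<i}. {w \<in> space M. (Sg w ^^ j) 0 = 0})"
  proof -
    have "card (orb (Sg w) 0) = i \<longleftrightarrow> (Sg w ^^ i) 0 = 0 \<and> (\<forall>j. 0 < j \<longrightarrow> j < i \<longrightarrow> (Sg w ^^ j) 0 \<noteq> 0)"
      if "w \<in> space M" for w
      using card_orb_eq_iff[OF inj[OF that] i] .
    then show ?thesis unfolding D_def by (simp cong: conj_cong) auto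
  qed
  also have "\<dots> \<in> sets M" using iter by (intro sets.Diff sets.finite_UN) auto
  finally have D: "D \<in> sets M" .
  have E: "E n \<in> sets M" "measure M (E n) = orbit_mean q (\<lambda>C. of_bool (card C = i)) n n" for n
    using pattern_prob_Collect[of n "\<lambda>p. card (orb p 0) = i"] by (simp_all add: E_def orbit_mean_def)
  have conv: "AE w in M. \<forall>i. eventually (\<lambda>n. ?pat n w i = Sg w i) sequentially"
    using mZ by (simp add: mallows_Z_def)
  have "(\<lambda>n. \<integral>w. indicator (E n) w \<partial>M) \<longlonglongrightarrow> (\<integral>w. indicator D w \<partial>M :: real)"
  proof (rule integral_dominated_convergence[where w = "\<lambda>_. 1"])
    show "AE w in M. (\<lambda>n. indicator (E n) w :: real) \<longlonglongrightarrow> indicator D w"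
      using conv AE_pattern_permutes
    proof eventually_elim
      case (elim w)
      show ?case
      proof (cases "w \<in> space M")
        case True
        have "inj (?pat n w)" for n using elim(2) permutes_inj by blast
        then have "eventually (\<lambda>n. card (orb (?pat n w) 0) = i \<longleftrightarrow> card (orb (Sg w) 0) = i) sequentially"
          using elim(1) inj[OF True] i by (intro card_orb_eventually_eq) auto
        then have "eventually (\<lambda>n. indicator (E n) w = (indicator D w :: real)) sequentially"
          by eventually_elim (use elim(2) True in \<open>simp add: D_def E_def indicator_def\<close>)
        then show ?thesis by (rule tendsto_eventually)
      qed (simp add: D_def E_def)
    qed
  qed (use D E in auto)
  then have "(\<lambda>n. measure M (E n)) \<longlonglongrightarrow> measure M D"
    using D E by simp
  moreover have "(\<lambda>n. measure M (E n)) \<longlonglongrightarrow> cycle_prob q i"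
  proof -
    have "filterlim (\<lambda>n::nat. (n, n)) (at_top \<times>\<^sub>F at_top) at_top"
      by (intro filterlim_Pair filterlim_ident)
    from filterlim_compose[OF orbit_mean_tendsto[OF q, of "\<lambda>C. of_bool (card C = i)"] this]
    show ?thesis by (simp add: cycle_prob_def E)
  qed
  ultimately show ?thesis unfolding D_def by (rule LIMSEQ_unique)
qed

end

section \<open>Bounds in the l1-norm and the final assembly\<close>

lemma mconst_summable:
  assumes "0 < q" "q < 1"
  shows "summable (\<lambda>i. \<bar>mconst q (Suc i)\<bar>)"
proof (rule summable_comparison_test'[OF sums_summable[OF mconst_sums[OF assms]], of 0])
  show "norm \<bar>mconst q (Suc i)\<bar> \<le> real (Suc i) * mconst q (Suc i)" for i
    using mconst_nonneg[OF assms, of "Suc i"] mult_right_mono[of 1 "real (Suc i)" "mconst q (Suc i)"] by simp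
qed

lemma mconst_l1_le:
  assumes "0 < q" "q < 1"
  shows "0 \<le> (\<Sum>i. \<bar>mconst q (Suc i)\<bar>)" "(\<Sum>i. \<bar>mconst q (Suc i)\<bar>) \<le> 1 - q"
proof -
  show "0 \<le> (\<Sum>i. \<bar>mconst q (Suc i)\<bar>)" by (intro suminf_nonneg mconst_summable assms) simp
  show "(\<Sum>i. \<bar>mconst q (Suc i)\<bar>) \<le> 1 - q"
    using sum_mconst_le[OF assms] mconst_nonneg[OF assms]
    by (intro suminf_le_const mconst_summable assms) simp
qed

text \<open>As \<open>m\<^sub>1 \<le> 1\<close> and \<open>m\<^sub>i \<le> i m\<^sub>i\<close>, the distance is at most \<open>(1 - m\<^sub>1) + (\<Sum>i m\<^sub>i - m\<^sub>1)\<close>.\<close>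

lemma mconst_l1_dist_le:
  assumes q: "0 < q" "q < 1"
  shows "0 \<le> (\<Sum>i. \<bar>mconst q (Suc i) - (if i = 0 then 1 else 0)\<bar>)"
    and "(\<Sum>i. \<bar>mconst q (Suc i) - (if i = 0 then 1 else 0)\<bar>) \<le> 2 * (1 - mconst q 1)"
proof -
  let ?f = "\<lambda>i. \<bar>mconst q (Suc i) - (if i = 0 then 1 else 0)\<bar>"
  \<comment> \<open>The correction at index 0 turns the term m_1 into 1 - m_1, the value of
    \<open>?f\<close> there.\<close>
  let ?g = "\<lambda>i. real (Suc i) * mconst q (Suc i) + (if i = 0 then 1 - 2 * mconst q 1 else 0)"
  have g: "?g sums (1 + (1 - 2 * mconst q 1))"
    by (intro sums_add mconst_sums q sums_single)
  have m1: "mconst q 1 \<le> 1"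
    using sum_le_suminf[OF sums_summable[OF mconst_sums[OF q]], of "{0}"] mconst_nonneg[OF q]
      sums_unique[OF mconst_sums[OF q]] by simp
  have le: "?f i \<le> ?g i" for i
    using m1 mconst_nonneg[OF q, of "Suc i"] mult_right_mono[of 1 "real (Suc i)" "mconst q (Suc i)"]
    by (cases i) auto
  have f: "summable ?f"
    by (rule summable_comparison_test'[OF sums_summable[OF g], of 0]) (use le in simp)
  then show "0 \<le> suminf ?f" by (rule suminf_nonneg) simp
  have "suminf ?f \<le> suminf ?g" using le f sums_summable[OF g] by (rule suminf_le)
  then show "suminf ?f \<le> 2 * (1 - mconst q 1)" using sums_unique[OF g] by simp
qed

lemma smallo_of_quadratic_bound:
  fixes f g :: "'a \<Rightarrow> real"
  assumes "eventually (\<lambda>x. \<bar>f x\<bar> \<le> K * (g x)\<^sup>2) F" "(g \<longlongrightarrow> 0) F"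
  shows "f \<in> o[F](g)"
proof (rule landau_o.smallI)
  fix c :: real assume c: "0 < c"
  have "((\<lambda>x. K * g x) \<longlongrightarrow> K * 0) F" by (intro tendsto_intros assms)
  then have "eventually (\<lambda>x. \<bar>K * g x\<bar> < c) F"
    using tendstoD[of _ "K * 0" F c] c by (simp add: dist_real_def)
  with assms(1) show "eventually (\<lambda>x. norm (f x) \<le> c * norm (g x)) F"
  proof eventually_elim
    case (elim x)
    have "\<bar>f x\<bar> \<le> \<bar>K * g x\<bar> * \<bar>g x\<bar>"
      using elim(1) by (simp add: power2_eq_square flip: abs_mult)
    also have "\<dots> \<le> c * \<bar>g x\<bar>" using elim(2) by (intro mult_right_mono) auto
    finally show ?case by simp
  qed
qed

theorem theorem1p4:
  fixes q :: real and M :: "'a measure" and Sg :: "'a \<Rightarrow> int \<Rightarrow> int"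
  assumes "0 < q" "q < 1" and "mallows_Z M q Sg"
  shows "(\<forall>i\<ge>1. (\<lambda>n. exp_cycles q i n / real n) \<longlonglongrightarrow> mconst q i)
    \<and> (\<forall>i\<ge>1. mconst q i = measure M {w\<in>space M. card (orb (Sg w) 0) = i} / real i)
    \<and> mconst q 1 = measure M {w\<in>space M. Sg w 0 = 0}
    \<and> (\<lambda>i. real (Suc i) * mconst q (Suc i)) sums 1
    \<and> ((\<lambda>p. \<Sum>i. \<bar>mconst p (Suc i) - (if i = 0 then 1 else 0)\<bar>) \<longlongrightarrow> 0) (at_right 0)
    \<and> ((\<lambda>p. \<Sum>i. \<bar>mconst p (Suc i)\<bar>) \<longlongrightarrow> 0) (at_left 1)
    \<and> (\<lambda>p. mconst p 1 - (1 - 2 * p)) \<in> o[at_right 0](\<lambda>p. p)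
    \<and> (\<lambda>p. mconst p 1 - (1 - p) / 4) \<in> o[at_left 1](\<lambda>p. 1 - p)"
proof (intro conjI allI impI)
  note q = assms(1,2)
  have right: "eventually (\<lambda>p::real. 0 < p \<and> p < 1) (at_right 0)"
    by (rule eventually_at_right_less[THEN eventually_conj]) (auto simp: eventually_at_right_field intro!: exI[of _ 1])
  have left: "eventually (\<lambda>p::real. 0 < p \<and> p < 1) (at_left 1)"
    by (auto simp: eventually_at_left_field intro!: exI[of _ 0])
  fix i :: nat
  show "(\<lambda>n. exp_cycles q i n / real n) \<longlonglongrightarrow> mconst q i" if "1 \<le> i"
    using exp_cycles_tendsto[OF q, of i] mconst_eq[OF q, of i] that by simp
  show "mconst q i = measure M {w\<in>space M. card (orb (Sg w) 0) = i} / real i" if "1 \<le> i"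
    using prob_card_orb[OF assms, of i] mconst_eq[OF q, of i] that by simp
  show "mconst q 1 = measure M {w\<in>space M. Sg w 0 = 0}"
    using prob_card_orb[OF assms, of 1] mconst_eq[OF q, of 1] by (simp add: card_orb_eq_1_iff[unfolded One_nat_def])
  show "(\<lambda>i. real (Suc i) * mconst q (Suc i)) sums 1"
    by (rule mconst_sums[OF q])
  show "((\<lambda>p. \<Sum>i. \<bar>mconst p (Suc i) - (if i = 0 then 1 else 0)\<bar>) \<longlongrightarrow> 0) (at_right 0)"
  proof (rule tendsto_sandwich[OF _ _ tendsto_const])
    \<comment> \<open>The bound 1 - m_1 <= 2p + 6p^2 comes from \<open>mconst_1_near_0\<close>; the
      outer factor 2 comes from \<open>mconst_l1_dist_le\<close>.\<close>
    have "((\<lambda>p. 2 * (2 * p + 6 * p\<^sup>2)) \<longlongrightarrow> 2 * (2 * 0 + 6 * 0\<^sup>2)) (at_right (0::real))"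
      by (intro tendsto_intros)
    then show "((\<lambda>p. 2 * (2 * p + 6 * p\<^sup>2)) \<longlongrightarrow> 0) (at_right (0::real))" by simp
    show "eventually (\<lambda>p. 0 \<le> (\<Sum>i. \<bar>mconst p (Suc i) - (if i = 0 then 1 else 0)\<bar>)) (at_right 0)"
      using right by eventually_elim (simp only: mconst_l1_dist_le)
    show "eventually (\<lambda>p. (\<Sum>i. \<bar>mconst p (Suc i) - (if i = 0 then 1 else 0)\<bar>) \<le> 2 * (2 * p + 6 * p\<^sup>2)) (at_right 0)"
      using right
    proof eventually_elim
      case (elim p)
      then have "(\<Sum>i. \<bar>mconst p (Suc i) - (if i = 0 then 1 else 0)\<bar>) \<le> 2 * (1 - mconst p 1)"
        by (intro mconst_l1_dist_le) auto
      also have "\<dots> \<le> 2 * (2 * p + 6 * p\<^sup>2)"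
        using abs_le_D2[OF mconst_1_near_0[OF conjunct1[OF elim] conjunct2[OF elim]]]
        by (intro mult_left_mono) simp_all
      finally show ?case .
    qed
  qed
  show "((\<lambda>p. \<Sum>i. \<bar>mconst p (Suc i)\<bar>) \<longlongrightarrow> 0) (at_left 1)"
  proof (rule tendsto_sandwich[OF _ _ tendsto_const])
    have "((\<lambda>p. 1 - p) \<longlongrightarrow> 1 - 1) (at_left (1::real))" by (intro tendsto_intros)
    then show "((\<lambda>p. 1 - p) \<longlongrightarrow> 0) (at_left (1::real))" by simp
    show "eventually (\<lambda>p. 0 \<le> (\<Sum>i. \<bar>mconst p (Suc i)\<bar>)) (at_left 1)"
      using left by eventually_elim (simp only: mconst_l1_le)
    show "eventually (\<lambda>p. (\<Sum>i. \<bar>mconst p (Suc i)\<bar>) \<le> 1 - p) (at_left 1)"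
      using left by eventually_elim (simp only: mconst_l1_le)
  qed
  show "(\<lambda>p. mconst p 1 - (1 - 2 * p)) \<in> o[at_right 0](\<lambda>p. p)"
  proof (rule smallo_of_quadratic_bound)
    show "eventually (\<lambda>p. \<bar>mconst p 1 - (1 - 2 * p)\<bar> \<le> 6 * p\<^sup>2) (at_right 0)"
      using right by eventually_elim (simp only: mconst_1_near_0)
  qed (rule tendsto_ident_at)
  show "(\<lambda>p. mconst p 1 - (1 - p) / 4) \<in> o[at_left 1](\<lambda>p. 1 - p)"
  proof (rule smallo_of_quadratic_bound)
    show "eventually (\<lambda>p. \<bar>mconst p 1 - (1 - p) / 4\<bar> \<le> 2 * (1 - p)\<^sup>2) (at_left 1)"
      using left by eventually_elim (simp only: mconst_1_near_1)
    have "((\<lambda>p. 1 - p) \<longlongrightarrow> 1 - 1) (at_left (1::real))" by (intro tendsto_intros)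
    then show "((\<lambda>p. 1 - p) \<longlongrightarrow> 0) (at_left (1::real))" by simp
  qed
qed

end
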